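(* Let $n\ge 1$, $N=\{0,1,\dots,n\}$, and let $\Delta=\operatorname{conv}\{\mathbf{x}_i : i\in N\}\subset\mathbb{R}^n$ be an $n$-simplex with vertices $\mathbf{x}_0,\dots,\mathbf{x}_n$. If $f\colon\Delta\to\mathbb{R}$ is a convex function and $K\subset L\subsetneq N$, then $$\frac{1}{\operatorname{Vol} \Delta^{[L]}}\int_{\Delta^{[L]}}f(\mathbf{x})\,\mathrm{d}\mathbf{x}\leq \frac{1}{\operatorname{Vol} \Delta^{[K]}}\int_{\Delta^{[K]}}f(\mathbf{x})\,\mathrm{d}\mathbf{x}.$$
   Context: The points $\mathbf{x}_0,\dots,\mathbf{x}_n\in\mathbb{R}^n$ are such that the vectors $\mathbf{x}_i-\mathbf{x}_0$, $i=1,\dots,n$, are linearly independent. For a subset $K\subset N$ of cardinality $k\le n$ and each $j\in N\setminus K$ put $$\mathbf{x}^{[K]}_j=\frac{1}{n+1}\sum_{i\in K}\mathbf{x}_i+\frac{n+1-k}{n+1}\mathbf{x}_j,\qquad \Delta^{[K]}=\operatorname{conv}\{\mathbf{x}^{[K]}_j : j\in N\setminus K\}.$$ Then $\Delta^{[K]}$ is an $(n-k)$-simplex; $\Delta^{[\emptyset]}=\Delta$, and $\Delta^{[K]}$ is the single point $\mathbf{b}=\frac{1}{n+1}(\mathbf{x}_0+\dots+\mathbf{x}_n)$ (the barycenter of $\Delta$) if $\operatorname{card}(N\setminus K)=1$. The integral over a $d$-dimensional simplex is with respect to $d$-dimensional Lebesgue measure (on its affine hull), and $\operatorname{Vol}$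 of a $d$-dimensional simplex is its $d$-dimensional volume. For $d=0$ this measure is counting measure, so the average of $f$ over the one-point simplex $\{\mathbf{b}\}$ is $f(\mathbf{b})$. The symbol $\subset$ denotes (not necessarily strict) inclusion. *)

theory Defs
  imports "HOL-Analysis.Analysis"
begin

text \<open>
  The Lebesgue measure of a \<open>d\<close>-dimensional affine subspace \<open>A\<close>: the image of the product
  Lebesgue measure on \<open>\<real>\<^sup>d\<close> under an isometric parametrisation
  \<open>c \<mapsto> a + (\<Sum>b\<in>B. c b *\<^sub>R b)\<close>, where \<open>a \<in> A\<close> and \<open>B\<close> is an orthonormal basis of the
  direction space of \<open>A\<close>. The result does not depend on \<open>a\<close> and \<open>B\<close>, so they are picked with
  \<open>SOME\<close>. For \<open>A = {a}\<close> the basis is empty and the measure is the unit point mass at \<open>a\<close>,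
  i.e. counting measure. It is completed, in the same way as \<^const>\<open>lebesgue\<close>.
\<close>

definition orthonormal_basis_of :: "'a::euclidean_space set \<Rightarrow> 'a set \<Rightarrow> bool" where
  "orthonormal_basis_of V B \<longleftrightarrow>
     pairwise orthogonal B \<and> (\<forall>b\<in>B. norm b = 1) \<and> span B = V"

definition affine_lebesgue :: "'a::euclidean_space set \<Rightarrow> 'a measure" where
  "affine_lebesgue A =
     (let a = (SOME a. a \<in> A);
          B = (SOME B. orthonormal_basis_of {u - v | u v. u \<in> A \<and> v \<in> A} B)
      in completion (distr (\<Pi>\<^sub>M b\<in>B. (lborel :: real measure)) borel
           (\<lambda>c. a + (\<Sum>b\<in>B. c b *\<^sub>R b))))"

definition rel_volume :: "'a::euclidean_space set \<Rightarrow> real" where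
  "rel_volume S = measure (affine_lebesgue (affine hull S)) S"

definition rel_integral :: "'a::euclidean_space set \<Rightarrow> ('a \<Rightarrow> real) \<Rightarrow> real" where
  "rel_integral S f = (LINT x:S|affine_lebesgue (affine hull S). f x)"

definition sub_vertex :: "nat \<Rightarrow> (nat \<Rightarrow> 'a::euclidean_space) \<Rightarrow> nat set \<Rightarrow> nat \<Rightarrow> 'a" where
  "sub_vertex n x K j =
     (1 / (real n + 1)) *\<^sub>R (\<Sum>i\<in>K. x i)
     + ((real n + 1 - real (card K)) / (real n + 1)) *\<^sub>R x j"

definition sub_simplex :: "nat \<Rightarrow> (nat \<Rightarrow> 'a::euclidean_space) \<Rightarrow> nat set \<Rightarrow> 'a set" where
  "sub_simplex n x K = convex hull (sub_vertex n x K ` ({0..n} - K))"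

end

theory Submission
  imports Defs "HOL-Probability.Probability"
begin

text \<open>
  Why the theorem holds. It suffices to treat \<open>L = insert p K\<close>. Let \<open>S\<close> be the sub-simplex of \<open>K\<close>,
  with \<open>m\<close> vertices, \<open>v\<close> its vertex with index \<open>p\<close> and \<open>F\<close> the facet opposite to \<open>v\<close>. The vertices of
  the sub-simplex of \<open>L\<close> are \<open>(1 / m) *\<^sub>R v + (1 - 1 / m) *\<^sub>R w\<close> for the vertices \<open>w\<close> of \<open>F\<close>: the smaller
  simplex is the section of \<open>S\<close> parallel to \<open>F\<close> through the barycenter of \<open>S\<close>
  (\<open>sub_vertex_insert\<close>). A uniformly distributed point of \<open>S\<close> can be written as
  \<open>\<tau> *\<^sub>R v + (1 - \<tau>) *\<^sub>R y\<close> with \<open>y\<close> uniform on \<open>F\<close> and independent of the height \<open>\<tau>\<close>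
  (\<open>uniform_on_cone\<close>). The average \<open>G \<tau>\<close> of \<open>f\<close> over the section at height \<open>\<tau>\<close> is a convex
  function of \<open>\<tau>\<close>, and the mean of \<open>\<tau>\<close> is \<open>1 / m\<close>
  (\<open>expectation_barycentric_coordinate\<close>). Jensen's inequality \<open>G (E \<tau>) \<le> E (G \<tau>)\<close> is the
  claim (\<open>average_on_section_le\<close>).

  Two technical points need care. The simplices have various dimensions and their Lebesgue measures
  are given by orthonormal bases of their affine hulls. All that matters about these measures is
  translation invariance, which determines them up to a factor (\<open>haar_on_unique\<close>), and the factor
  cancels in averages. So averages are equivariant under affine maps
  (\<open>uniform_on_affine_image\<close>) and computable by slicing
  (\<open>haar_on_affine_hull_insert\<close>), and no determinant or volume is ever evaluated; even the mean
  height follows from the symmetry of the simplex.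

  Secondly, a convex function on a closed simplex can jump at the relative boundary. The
  relative boundary is a null set (\<open>AE_uniform_on_rel_interior\<close>), so in the completed measure the
  integral is that of the cut-off function, which is Borel measurable and bounded
  (\<open>rel_integral_div_rel_volume\<close>, \<open>convex_on_polytope_bounded\<close>).
\<close>

section \<open>Translation-invariant measures on an affine subspace\<close>

text \<open>
  The Haar measures of the affine space \<open>A\<close>: Borel measures on the ambient space that are
  concentrated on \<open>A\<close>, nonzero, finite on bounded sets and invariant under the translations
  that preserve \<open>A\<close>. They live on the ambient type, so that measures on subspaces of
  different dimensions can be compared without coordinates.
\<close>

definition haar_on :: "'a::euclidean_space set \<Rightarrow> 'a measure \<Rightarrow> bool" where
  "haar_on A \<mu> \<longleftrightarrow>
     sets \<mu> = sets borel \<and> (AE x in \<mu>. x \<in> A) \<and> emeasure \<mu> UNIV \<noteq> 0 \<and>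
     (\<forall>r. emeasure \<mu> (cball 0 r) < \<infinity>) \<and>
     (\<forall>u\<in>A. \<forall>v\<in>A. distr \<mu> borel (\<lambda>x. x + (u - v)) = \<mu>)"

lemma haar_onD:
  assumes "haar_on A \<mu>"
  shows "sets \<mu> = sets borel" "space \<mu> = UNIV" "AE x in \<mu>. x \<in> A" "emeasure \<mu> UNIV \<noteq> 0"
    "emeasure \<mu> (cball 0 r) < \<infinity>"
  using assms sets_eq_imp_space_eq[of \<mu> borel] unfolding haar_on_def by auto

lemma haar_on_nonempty:
  assumes "haar_on A \<mu>" shows "A \<noteq> {}"
proof
  assume "A = {}"
  then have "AE x in \<mu>. False" using haar_onD(3)[OF assms] by simp
  then have "emeasure \<mu> (space \<mu>) = 0"
    by (simp add: AE_iff_null_sets null_setsD1)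
  then show False using haar_onD(2,4)[OF assms] by simp
qed

lemma haar_on_sigma_finite:
  assumes "haar_on A \<mu>" shows "sigma_finite_measure \<mu>"
proof
  have "(\<Union>n. cball (0::'a) (real n)) = UNIV"
    by (auto intro: real_arch_simple)
  then show "\<exists>\<A>. countable \<A> \<and> \<A> \<subseteq> sets \<mu> \<and> \<Union>\<A> = space \<mu> \<and> (\<forall>a\<in>\<A>. emeasure \<mu> a \<noteq> \<infinity>)"
    using haar_onD[OF assms]
    by (intro exI[of _ "range (\<lambda>n. cball 0 (real n))"]) (auto simp: less_top)
qed

lemma haar_on_positive_cball:
  assumes "haar_on A \<mu>" obtains r where "emeasure \<mu> (cball 0 r) \<noteq> 0"
proof (rule ccontr)
  assume *: "\<not> thesis"
  have U: "(\<Union>n. cball (0::'a) (real n)) = UNIV"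
    by (auto intro: real_arch_simple)
  have "(\<Union>n. cball (0::'a) (real n)) \<in> null_sets \<mu>"
    using * that haar_onD(1)[OF assms] by (intro null_sets_UN) (auto intro!: null_setsI)
  then show False using U haar_onD(4)[OF assms] by auto
qed

lemma haar_on_nn_integral_translate:
  fixes A :: "'a::euclidean_space set"
  assumes "haar_on A \<mu>" "u \<in> A" "v \<in> A" "k \<in> borel_measurable borel"
  shows "(\<integral>\<^sup>+x. k (x + (u - v)) \<partial>\<mu>) = (\<integral>\<^sup>+x. k x \<partial>\<mu>)"
proof -
  have [measurable_cong]: "sets \<mu> = sets borel" using haar_onD assms by blast
  have "(\<integral>\<^sup>+x. k x \<partial>\<mu>) = (\<integral>\<^sup>+x. k x \<partial>distr \<mu> borel (\<lambda>x. x + (u - v)))"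
    using assms unfolding haar_on_def by simp
  also have "\<dots> = (\<integral>\<^sup>+x. k (x + (u - v)) \<partial>\<mu>)"
    using assms(4) by (subst nn_integral_distr) auto
  finally show ?thesis by simp
qed

text \<open>
  This is the usual argument for the uniqueness of Haar measure. Choose a bounded set \<open>G\<close> of
  positive \<open>\<nu>\<close>-measure and fix \<open>a \<in> A\<close>. In \<open>\<mu> X * \<nu> G\<close>, written as a double integral,
  translate \<open>x\<close> by \<open>y - a\<close>, then \<open>y\<close> by \<open>a - x\<close>, then \<open>x\<close> by \<open>y - a\<close> again, exchanging
  the order of integration in between: the result is \<open>C * \<nu> X\<close> with \<open>C\<close> the \<open>\<mu>\<close>-measure of
  the reflection of \<open>G\<close> in \<open>a\<close>. In an average the constant cancels, and so
  this lemma takes the place of Jacobian determinants throughout.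
\<close>

lemma haar_on_unique:
  fixes A :: "'a::euclidean_space set"
  assumes \<mu>: "haar_on A \<mu>" and \<nu>: "haar_on A \<nu>"
  obtains c where "c \<noteq> 0" "c \<noteq> \<infinity>" "\<And>X. X \<in> sets borel \<Longrightarrow> emeasure \<mu> X = c * emeasure \<nu> X"
proof -
  have [measurable_cong]: "sets \<mu> = sets borel" "sets \<nu> = sets borel"
    using haar_onD \<mu> \<nu> by blast+
  interpret M: sigma_finite_measure \<mu> using \<mu> by (rule haar_on_sigma_finite)
  interpret N: sigma_finite_measure \<nu> using \<nu> by (rule haar_on_sigma_finite)
  interpret P: pair_sigma_finite \<mu> \<nu> ..
  obtain a where a: "a \<in> A" using haar_on_nonempty[OF \<mu>] by blast
  obtain r where r: "emeasure \<nu> (cball 0 r) \<noteq> 0" using haar_on_positive_cball[OF \<nu>] .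
  define G where "G = cball (0::'a) r"
  have [measurable]: "G \<in> sets borel" by (simp add: G_def)
  have G: "emeasure \<nu> G \<noteq> 0" "emeasure \<nu> G \<noteq> \<infinity>" "emeasure \<mu> G \<noteq> \<infinity>"
    using r haar_onD(5)[OF \<nu>] haar_onD(5)[OF \<mu>] by (auto simp: G_def less_top)
  define C where "C = (\<integral>\<^sup>+x. indicator G (2 *\<^sub>R a - x) \<partial>\<mu>)"
  have key: "emeasure \<mu> X * emeasure \<nu> G = C * emeasure \<nu> X" if [measurable]: "X \<in> sets borel" for X
  proof -
    let ?f = "indicator X :: 'a \<Rightarrow> ennreal" and ?g = "indicator G :: 'a \<Rightarrow> ennreal"
    have "emeasure \<mu> X * emeasure \<nu> G = (\<integral>\<^sup>+y. (\<integral>\<^sup>+x. ?f x \<partial>\<mu>) * ?g y \<partial>\<nu>)"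
      by (simp add: nn_integral_cmult)
    also have "\<dots> = (\<integral>\<^sup>+y. (\<integral>\<^sup>+x. ?f (x + (y - a)) \<partial>\<mu>) * ?g y \<partial>\<nu>)"
    proof (rule nn_integral_cong_AE, use haar_onD(3)[OF \<nu>] in eventually_elim)
      case (elim y)
      show ?case using haar_on_nn_integral_translate[OF \<mu> elim a, of ?f] by simp
    qed
    also have "\<dots> = (\<integral>\<^sup>+y. (\<integral>\<^sup>+x. ?f (x + (y - a)) * ?g y \<partial>\<mu>) \<partial>\<nu>)"
      by (intro nn_integral_cong nn_integral_multc[symmetric]) simp
    also have "\<dots> = (\<integral>\<^sup>+x. (\<integral>\<^sup>+y. ?f (x + (y - a)) * ?g y \<partial>\<nu>) \<partial>\<mu>)"
      by (rule P.Fubini') simp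
    also have "\<dots> = (\<integral>\<^sup>+x. (\<integral>\<^sup>+y. ?f y * ?g (y + (a - x)) \<partial>\<nu>) \<partial>\<mu>)"
    proof (rule nn_integral_cong_AE, use haar_onD(3)[OF \<mu>] in eventually_elim)
      case (elim x)
      show ?case
        using haar_on_nn_integral_translate[OF \<nu> a elim, of "\<lambda>y. ?f (x + (y - a)) * ?g y"]
        by (simp add: algebra_simps)
    qed
    also have "\<dots> = (\<integral>\<^sup>+y. (\<integral>\<^sup>+x. ?f y * ?g (y + (a - x)) \<partial>\<mu>) \<partial>\<nu>)"
      by (rule P.Fubini'[symmetric]) simp
    also have "\<dots> = (\<integral>\<^sup>+y. ?f y * (\<integral>\<^sup>+x. ?g (y + (a - x)) \<partial>\<mu>) \<partial>\<nu>)"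
      by (intro nn_integral_cong nn_integral_cmult) simp
    also have "\<dots> = (\<integral>\<^sup>+y. ?f y * C \<partial>\<nu>)"
    proof (rule nn_integral_cong_AE, use haar_onD(3)[OF \<nu>] in eventually_elim)
      case (elim y)
      show ?case
        using haar_on_nn_integral_translate[OF \<mu> elim a, of "\<lambda>x. ?g (y + (a - x))"]
        by (simp add: C_def algebra_simps scaleR_2)
    qed
    also have "\<dots> = C * emeasure \<nu> X"
      by (subst nn_integral_multc) (simp_all add: mult.commute)
    finally show ?thesis .
  qed
  have C0: "C \<noteq> 0"
    using key[of UNIV] G(1) haar_onD(4)[OF \<mu>] by auto
  have C1: "C \<noteq> \<infinity>"
    using key[of G] G by (auto simp: ennreal_mult_eq_top_iff ennreal_top_mult)
  show ?thesis
  proof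
    show "C / emeasure \<nu> G \<noteq> 0" "C / emeasure \<nu> G \<noteq> \<infinity>"
      using C0 C1 G by (auto simp: ennreal_divide_eq_top_iff)
    fix X :: "'a set" assume "X \<in> sets borel"
    from key[OF this] have "emeasure \<mu> X * emeasure \<nu> G / emeasure \<nu> G = C * emeasure \<nu> X / emeasure \<nu> G"
      by simp
    then show "emeasure \<mu> X = C / emeasure \<nu> G * emeasure \<nu> X"
      using G by (simp add: ennreal_mult_divide_eq ennreal_times_divide mult.commute ennreal_divide_times)
  qed
qed

lemma haar_on_bounded:
  assumes "haar_on A \<mu>" "bounded S" shows "emeasure \<mu> S < \<infinity>"
proof -
  obtain r where "S \<subseteq> cball 0 r"
    using bounded_subset_ballD[OF assms(2), of 0] ball_subset_cball by blast
  then have "emeasure \<mu> S \<le> emeasure \<mu> (cball 0 r)"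
    using haar_onD(1)[OF assms(1)] by (intro emeasure_mono) auto
  also have "\<dots> < \<infinity>" using haar_onD(5)[OF assms(1)] .
  finally show ?thesis .
qed

text \<open>
  Invariance is transported along \<open>\<phi>\<close> directly. Finiteness on bounded sets needs injectivity: a
  linear left inverse of \<open>M\<close> on the direction space shows that the part of \<open>A\<close> mapped into a
  ball is bounded.
\<close>

lemma haar_on_affine_image:
  fixes \<phi> :: "'a::euclidean_space \<Rightarrow> 'b::euclidean_space"
  assumes \<mu>: "haar_on A \<mu>" and M: "linear M" and \<phi>: "\<And>z. \<phi> z = c + M z"
    and inj: "inj_on \<phi> A" and A: "affine A"
  shows "haar_on (\<phi> ` A) (distr \<mu> borel \<phi>)"
proof -
  have S[measurable_cong]: "sets \<mu> = sets borel" using haar_onD \<mu> by blast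
  have sp: "space \<mu> = UNIV" using haar_onD \<mu> by blast
  have Mc: "continuous_on X M" for X using M linear_continuous_on linear_conv_bounded_linear by blast
  have [measurable]: "M \<in> borel_measurable borel"
    using Mc by (rule borel_measurable_continuous_onI)
  have [measurable]: "\<phi> \<in> borel_measurable borel" unfolding \<phi> by measurable
  obtain a where a: "a \<in> A" using haar_on_nonempty[OF \<mu>] by blast
  define V where "V = (\<lambda>x. x - a) ` A"
  have V: "subspace V" unfolding V_def using affine_diffs_subspace_subtract[OF A a] .
  have injV: "inj_on M V"
  proof (rule inj_onI)
    fix u v assume "u \<in> V" "v \<in> V" and e: "M u = M v"
    then obtain x y where x: "x \<in> A" "u = x - a" "y \<in> A" "v = y - a" unfolding V_def by auto
    then have "\<phi> x = \<phi> y" using e M by (simp add: \<phi> linear_diff)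
    then show "u = v" using inj x by (auto dest: inj_onD)
  qed
  obtain g where g: "linear g" "\<forall>v\<in>V. g (M v) = v"
    using linear_exists_left_inverse_on[OF M V injV] by blast
  have g': "x = g (\<phi> x - \<phi> a) + a" if "x \<in> A" for x
  proof -
    have "\<phi> x - \<phi> a = M (x - a)" using M by (simp add: \<phi> linear_diff)
    then show ?thesis using g(2) that unfolding V_def by auto
  qed
  have gb: "bounded ((\<lambda>y. g (y - \<phi> a) + a) ` B)" if "bounded B" for B
  proof -
    have "bounded ((+) a ` g ` (+) (- \<phi> a) ` B)"
      using g(1) that by (intro bounded_translation bounded_linear_image)
         (auto simp: linear_conv_bounded_linear)
    then show ?thesis by (simp add: image_image add.commute)
  qed
  show ?thesis unfolding haar_on_def
  proof (intro conjI allI ballI)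
    show "sets (distr \<mu> borel \<phi>) = sets borel" by simp
    have "AE x in \<mu>. \<phi> x \<in> \<phi> ` A" using haar_onD(3)[OF \<mu>] by eventually_elim auto
    moreover have "closed (\<phi> ` A)"
    proof -
      have "affine (\<phi> ` A)"
      proof -
        have "\<phi> ` A = (+) c ` M ` A" by (auto simp: \<phi> image_image)
        moreover have "affine hull (M ` A) = M ` A"
          using affine_hull_linear_image[of M A] M A affine_hull_eq
          by (metis linear_conv_bounded_linear)
        ultimately show ?thesis by (metis affine_affine_hull affine_translation)
      qed
      then show ?thesis by (rule affine_closed)
    qed
    ultimately show "AE x in distr \<mu> borel \<phi>. x \<in> \<phi> ` A"
      by (subst AE_distr_iff) auto
    show "emeasure (distr \<mu> borel \<phi>) UNIV \<noteq> 0"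
      using haar_onD(4)[OF \<mu>] by (simp add: emeasure_distr sp)
    fix r
    have "emeasure (distr \<mu> borel \<phi>) (cball 0 r) = emeasure \<mu> (\<phi> -` cball 0 r)"
      by (simp add: emeasure_distr sp)
    also have "\<dots> = emeasure \<mu> (\<phi> -` cball 0 r \<inter> A)"
    proof (rule emeasure_eq_AE)
      show "AE x in \<mu>. (x \<in> \<phi> -` cball 0 r) = (x \<in> \<phi> -` cball 0 r \<inter> A)"
        using haar_onD(3)[OF \<mu>] by eventually_elim auto
      have vim: "\<phi> -` cball 0 r \<in> sets borel"
        using measurable_sets[of \<phi> borel borel "cball 0 r"] by simp
      then show "\<phi> -` cball 0 r \<in> sets \<mu>" using S by simp
      show "\<phi> -` cball 0 r \<inter> A \<in> sets \<mu>"
        using S affine_closed[OF A] vim by auto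
    qed
    also have "\<dots> < \<infinity>"
    proof (rule haar_on_bounded[OF \<mu>])
      have "\<phi> -` cball 0 r \<inter> A \<subseteq> (\<lambda>y. g (y - \<phi> a) + a) ` cball 0 r"
        using g' by auto
      then show "bounded (\<phi> -` cball 0 r \<inter> A)" using gb[of "cball 0 r"] bounded_subset by auto
    qed
    finally show "emeasure (distr \<mu> borel \<phi>) (cball 0 r) < \<infinity>" .
  next
    fix u v assume "u \<in> \<phi> ` A" "v \<in> \<phi> ` A"
    then obtain x y where x: "x \<in> A" "u = \<phi> x" "y \<in> A" "v = \<phi> y" by auto
    have "distr (distr \<mu> borel \<phi>) borel (\<lambda>z. z + (u - v)) = distr \<mu> borel (\<lambda>z. \<phi> z + (u - v))"
      by (subst distr_distr) (auto simp: o_def)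
    also have "(\<lambda>z. \<phi> z + (u - v)) = (\<lambda>z. \<phi> (z + (x - y)))"
      using M by (auto simp: x \<phi> linear_add linear_diff)
    also have "distr \<mu> borel \<dots> = distr (distr \<mu> borel (\<lambda>z. z + (x - y))) borel \<phi>"
      by (subst distr_distr) (auto simp: o_def)
    also have "distr \<mu> borel (\<lambda>z. z + (x - y)) = \<mu>"
      using \<mu> x unfolding haar_on_def by blast
    finally show "distr (distr \<mu> borel \<phi>) borel (\<lambda>z. z + (u - v)) = distr \<mu> borel \<phi>" .
  qed
qed

text \<open>
  Adding one dimension: \<open>\<tau> *\<^sub>R (v - q) + y\<close> are coordinates on the affine hull of \<open>insert v A\<close>
  with \<open>\<tau>\<close> real and \<open>y \<in> A\<close>, and the product measure is translation invariant in them. The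
  inverse \<open>T\<close> of these coordinates is continuous, so bounded sets have bounded coordinates.
  This is the form of Fubini's theorem by which a cone is sliced parallel to its base.
\<close>

lemma haar_on_affine_hull_insert:
  fixes A :: "'a::euclidean_space set"
  assumes \<mu>: "haar_on A \<mu>" and A: "affine A" and q: "q \<in> A" and v: "v \<notin> A"
  defines "\<Psi> \<equiv> \<lambda>(\<tau>::real, y). \<tau> *\<^sub>R (v - q) + y"
  shows "haar_on (affine hull (insert v A)) (distr (lborel \<Otimes>\<^sub>M \<mu>) borel \<Psi>)"
proof -
  let ?P = "(lborel :: real measure) \<Otimes>\<^sub>M \<mu>"
  have S[measurable_cong]: "sets \<mu> = sets borel" using haar_onD \<mu> by blast
  have sp: "space \<mu> = UNIV" using haar_onD \<mu> by blast
  interpret M: sigma_finite_measure \<mu> using \<mu> by (rule haar_on_sigma_finite)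
  interpret P: pair_sigma_finite lborel \<mu> ..
  have m[measurable]: "\<Psi> \<in> ?P \<rightarrow>\<^sub>M borel"
    unfolding \<Psi>_def by measurable
  define V where "V = (\<lambda>x. x - q) ` A"
  have V: "subspace V" unfolding V_def using affine_diffs_subspace_subtract[OF A q] .
  have vV: "v - q \<notin> V" using v unfolding V_def by auto
  have AV: "y \<in> A \<longleftrightarrow> y - q \<in> V" for y unfolding V_def by (auto simp: image_iff)
  \<comment> \<open>a linear functional with value \<open>1\<close> at \<open>v - q\<close> that vanishes on the direction space\<close>
  obtain e where e: "e \<bullet> (v - q) = 1" "\<And>y. y \<in> V \<Longrightarrow> e \<bullet> y = 0"
  proof -
    obtain a where a: "a \<in> span V" "\<And>x. x \<in> span V \<Longrightarrow> orthogonal (v - q - a) x"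
      by (metis orthogonal_subspace_decomp_exists add_diff_cancel_left')
    define w where "w = v - q - a"
    have aV: "a \<in> V" using a V by (metis span_eq_iff)
    then have w0: "w \<noteq> 0" using vV by (auto simp: w_def)
    have wV: "w \<bullet> y = 0" if "y \<in> V" for y
      using a(2)[of y] that span_superset unfolding w_def orthogonal_def by blast
    have "w \<bullet> (v - q) = w \<bullet> w" using wV[OF aV] by (simp add: w_def inner_diff_right)
    with w0 show ?thesis
      by (intro that[of "w /\<^sub>R (w \<bullet> w)"]) (auto simp: wV)
  qed
  define T where "T z = (e \<bullet> z - e \<bullet> q, z - (e \<bullet> z - e \<bullet> q) *\<^sub>R (v - q))" for z
  have T\<Psi>: "T (\<Psi> (\<tau>, y)) = (\<tau>, y)" if "y \<in> A" for \<tau> y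
  proof -
    have "e \<bullet> y = e \<bullet> q" using e(2)[of "y - q"] that by (simp add: AV inner_diff_right)
    then have "e \<bullet> \<Psi> (\<tau>, y) - e \<bullet> q = \<tau>"
      using e(1) by (simp add: \<Psi>_def inner_add_right)
    then show ?thesis by (simp add: T_def \<Psi>_def)
  qed
  have H: "affine hull (insert v A) = {\<Psi> (\<tau>, y) | \<tau> y. y \<in> A}"
  proof -
    have "z \<in> affine hull (insert v A) \<longleftrightarrow> (\<exists>\<tau>. z - \<tau> *\<^sub>R (v - q) \<in> A)" for z
    proof -
      have "affine hull (insert q (insert v A)) = (\<lambda>x. q + x) ` span ((\<lambda>x. - q + x) ` insert v A)"
        by (rule affine_hull_insert_span_gen)
      moreover have "insert q (insert v A) = insert v A" using q by auto
      moreover have "(\<lambda>x. - q + x) ` insert v A = insert (v - q) V" unfolding V_def by auto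
      ultimately have "affine hull (insert v A) = (\<lambda>x. q + x) ` span (insert (v - q) V)" by simp
      then have "z \<in> affine hull (insert v A) \<longleftrightarrow> z - q \<in> span (insert (v - q) V)"
        by (auto simp: image_iff intro: bexI[of _ "z - q"])
      also have "\<dots> \<longleftrightarrow> (\<exists>k. z - q - k *\<^sub>R (v - q) \<in> V)"
        using V by (simp add: span_insert span_eq_iff[THEN iffD2])
      also have "\<dots> \<longleftrightarrow> (\<exists>k. z - k *\<^sub>R (v - q) \<in> A)"
        by (simp add: AV algebra_simps)
      finally show ?thesis .
    qed
    moreover have "(\<exists>\<tau>. z - \<tau> *\<^sub>R (v - q) \<in> A) \<longleftrightarrow> (\<exists>\<tau> y. z = \<Psi> (\<tau>, y) \<and> y \<in> A)" for z
    proof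
      assume "\<exists>\<tau>. z - \<tau> *\<^sub>R (v - q) \<in> A"
      then obtain \<tau> where "z - \<tau> *\<^sub>R (v - q) \<in> A" ..
      then show "\<exists>\<tau> y. z = \<Psi> (\<tau>, y) \<and> y \<in> A"
        by (intro exI[of _ \<tau>] exI[of _ "z - \<tau> *\<^sub>R (v - q)"]) (simp add: \<Psi>_def)
    next
      assume "\<exists>\<tau> y. z = \<Psi> (\<tau>, y) \<and> y \<in> A"
      then obtain \<tau> y where "z = \<Psi> (\<tau>, y)" "y \<in> A" by blast
      then show "\<exists>\<tau>. z - \<tau> *\<^sub>R (v - q) \<in> A"
        by (intro exI[of _ \<tau>]) (simp add: \<Psi>_def)
    qed
    ultimately show ?thesis by blast
  qed
  have AE: "AE p in ?P. snd p \<in> A"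
  proof (rule P.AE_pair_measure)
    have [measurable]: "A \<in> sets borel" using affine_closed[OF A] by simp
    show "{x \<in> space ?P. snd x \<in> A} \<in> sets ?P" by measurable
    show "AE x in lborel. AE y in \<mu>. snd (x::real, y) \<in> A" using haar_onD(3)[OF \<mu>] by simp
  qed
  show ?thesis unfolding haar_on_def
  proof (intro conjI allI ballI)
    show "AE x in distr ?P borel \<Psi>. x \<in> affine hull insert v A"
    proof (subst AE_distr_iff)
      show "{x \<in> space borel. x \<in> affine hull insert v A} \<in> sets borel"
        using borel_closed[OF closed_affine_hull] by simp
      show "AE x in ?P. \<Psi> x \<in> affine hull insert v A"
        using AE by eventually_elim (unfold H, force)
    qed fact
    have "emeasure ?P (UNIV \<times> UNIV) = emeasure lborel (UNIV::real set) * emeasure \<mu> UNIV"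
      by (rule M.emeasure_pair_measure_Times) (auto simp: S)
    then show "emeasure (distr ?P borel \<Psi>) UNIV \<noteq> 0"
      using haar_onD(4)[OF \<mu>] by (simp add: emeasure_distr space_pair_measure sp)
    fix r
    have A1: "emeasure (distr ?P borel \<Psi>) (cball 0 r) = emeasure ?P (\<Psi> -` cball 0 r)"
      by (simp add: emeasure_distr space_pair_measure sp)
    have Tb: "bounded (T ` cball 0 r)"
    proof (intro compact_imp_bounded compact_continuous_image)
      show "continuous_on (cball 0 r) T" unfolding T_def by (intro continuous_intros)
    qed simp
    then obtain R where R: "T ` cball 0 r \<subseteq> cball 0 R"
      using bounded_subset_ballD[OF Tb, of 0] ball_subset_cball by blast
    have "emeasure ?P (\<Psi> -` cball 0 r) \<le> emeasure ?P (cball 0 R \<times> cball 0 R)"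
    proof (rule emeasure_mono_AE)
      show "cball 0 R \<times> cball 0 R \<in> sets ?P" by (simp add: S)
      show "AE x in ?P. x \<in> \<Psi> -` cball 0 r \<longrightarrow> x \<in> cball 0 R \<times> cball 0 R"
        using AE
      proof eventually_elim
        case (elim p)
        obtain \<tau> y where p: "p = (\<tau>, y)" by force
        show ?case
        proof
          assume "p \<in> \<Psi> -` cball 0 r"
          then have "T (\<Psi> p) \<in> cball 0 R" using R by (meson image_subset_iff vimageE)
          then have "norm (\<tau>, y) \<le> R" using T\<Psi> elim p by simp
          then show "p \<in> cball 0 R \<times> cball 0 R"
            using norm_fst_le[of \<tau> y] norm_snd_le[of y \<tau>] by (simp add: p)
        qed
      qed
    qed
    also have "\<dots> = emeasure lborel (cball (0::real) R) * emeasure \<mu> (cball 0 R)"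
      by (rule M.emeasure_pair_measure_Times) (auto simp: S)
    also have "\<dots> < \<infinity>"
      using haar_onD(5)[OF \<mu>, of R] emeasure_lborel_cball_finite[of "0::real" R]
      by (auto simp: ennreal_mult_less_top)
    finally show "emeasure (distr ?P borel \<Psi>) (cball 0 r) < \<infinity>" using A1 by simp
  next
    fix u w assume "u \<in> affine hull insert v A" "w \<in> affine hull insert v A"
    then obtain s x t y where uw: "u = \<Psi> (s, x)" "x \<in> A" "w = \<Psi> (t, y)" "y \<in> A" unfolding H by blast
    have "?P = distr lborel borel (\<lambda>\<tau>. \<tau> + (s - t)) \<Otimes>\<^sub>M distr \<mu> borel (\<lambda>z. z + (x - y))"
    proof -
      have "distr \<mu> borel (\<lambda>z. z + (x - y)) = \<mu>" using \<mu> uw unfolding haar_on_def by blast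
      moreover have "distr lborel borel (\<lambda>\<tau>. \<tau> + (s - t)) = lborel"
      proof -
        have "(\<lambda>\<tau>. \<tau> + (s - t)) = (+) (s - t)" by (simp add: fun_eq_iff)
        then show ?thesis by (simp add: lborel_distr_plus)
      qed
      ultimately show ?thesis by simp
    qed
    also have "\<dots> = distr ?P (borel \<Otimes>\<^sub>M borel) (\<lambda>(\<tau>, z). (\<tau> + (s - t), z + (x - y)))"
    proof (rule pair_measure_distr)
      have "distr \<mu> borel (\<lambda>z. z + (x - y)) = \<mu>" using \<mu> uw unfolding haar_on_def by blast
      then show "sigma_finite_measure (distr \<mu> borel (\<lambda>z. z + (x - y)))"
        using M.sigma_finite_measure_axioms by simp
    qed auto
    finally have inv: "?P = \<dots>" .
    have "distr (distr ?P borel \<Psi>) borel (\<lambda>z. z + (u - w)) =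
        distr ?P borel (\<lambda>p. \<Psi> p + (u - w))"
      by (subst distr_distr) (auto simp: o_def)
    also have "(\<lambda>p. \<Psi> p + (u - w)) = \<Psi> \<circ> (\<lambda>(\<tau>, z). (\<tau> + (s - t), z + (x - y)))"
      by (auto simp: fun_eq_iff \<Psi>_def uw algebra_simps)
    also have "distr ?P borel \<dots> =
        distr (distr ?P (borel \<Otimes>\<^sub>M borel) (\<lambda>(\<tau>, z). (\<tau> + (s - t), z + (x - y)))) borel \<Psi>"
    proof (rule distr_distr[symmetric])
      show "\<Psi> \<in> borel \<Otimes>\<^sub>M borel \<rightarrow>\<^sub>M borel" unfolding \<Psi>_def by measurable
    qed measurable
    also have "\<dots> = distr ?P borel \<Psi>" using inv by simp
    finally show "distr (distr ?P borel \<Psi>) borel (\<lambda>z. z + (u - w)) =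
        distr ?P borel \<Psi>" .
  qed simp
qed

section \<open>The Lebesgue measure of an affine subspace\<close>

text \<open>
  The coordinates of a point of \<open>A\<close> with respect to an orthonormal basis are its inner products
  with the basis vectors, hence bounded on balls, and a translation of \<open>A\<close> is a translation of
  each coordinate.
\<close>

lemma haar_on_orthonormal:
  fixes A :: "'a::euclidean_space set"
  assumes B: "orthonormal_basis_of {u - v | u v. u \<in> A \<and> v \<in> A} B"
    and A: "affine A" and a: "a \<in> A"
  shows "haar_on A (distr (\<Pi>\<^sub>M b\<in>B. (lborel :: real measure)) borel (\<lambda>c. a + (\<Sum>b\<in>B. c b *\<^sub>R b)))"
proof -
  have orth: "pairwise orthogonal B" and nrm: "\<And>b. b \<in> B \<Longrightarrow> norm b = 1"
    and span: "span B = {u - v | u v. u \<in> A \<and> v \<in> A}"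
    using B unfolding orthonormal_basis_of_def by auto
  have "independent B"
    using pairwise_orthogonal_independent[OF orth] nrm by force
  then have fin[simp]: "finite B" using independent_imp_finite by blast
  interpret product_sigma_finite "\<lambda>_::'a. lborel :: real measure" ..
  define P where "P = (\<Pi>\<^sub>M b\<in>B. (lborel :: real measure))"
  define T where "T c = a + (\<Sum>b\<in>B. c b *\<^sub>R b)" for c
  have [measurable]: "(\<lambda>c. c b) \<in> borel_measurable P" if "b \<in> B" for b
    using measurable_component_singleton[OF that, of "\<lambda>_. lborel :: real measure"] unfolding P_def by simp
  have [measurable]: "T \<in> borel_measurable P" unfolding T_def
    by (intro borel_measurable_add borel_measurable_const borel_measurable_sum borel_measurable_scaleR) simp
  have Pi: "emeasure P (Pi\<^sub>E B X) = (\<Prod>b\<in>B. emeasure lborel (X b))" if "\<And>b. b \<in> B \<Longrightarrow> X b \<in> sets borel" for X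
    unfolding P_def using that by (intro emeasure_PiM) auto
  have sp: "space P = Pi\<^sub>E B (\<lambda>_. UNIV)" by (simp add: P_def space_PiM)
  have TA: "T c \<in> A" for c
  proof -
    have "(\<Sum>b\<in>B. c b *\<^sub>R b) \<in> span B" by (intro span_sum span_scale span_base)
    then obtain u v where "u \<in> A" "v \<in> A" "(\<Sum>b\<in>B. c b *\<^sub>R b) = u - v" using span by auto
    then show ?thesis using mem_affine_3_minus[OF A a, of u v 1] by (simp add: T_def)
  qed
  have coord: "(T c - a) \<bullet> b = c b" if "b \<in> B" for b c
  proof -
    have "(T c - a) \<bullet> b = (\<Sum>b'\<in>B. c b' * (b' \<bullet> b))" by (simp add: T_def inner_sum_left)
    also have "\<dots> = (\<Sum>b'\<in>B. if b' = b then c b else 0)"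
    proof (intro sum.cong refl)
      fix b' assume "b' \<in> B"
      then show "c b' * (b' \<bullet> b) = (if b' = b then c b else 0)"
        using orth nrm that by (auto simp: pairwise_def orthogonal_def norm_eq_1)
    qed
    finally show ?thesis using that by simp
  qed
  have "haar_on A (distr P borel T)"
    unfolding haar_on_def
  proof (intro conjI allI ballI)
    show "AE x in distr P borel T. x \<in> A"
      using TA affine_closed[OF A] by (subst AE_distr_iff) (auto)
    have "1 = emeasure P (Pi\<^sub>E B (\<lambda>_. {0..1}))" by (subst Pi) auto
    also have "\<dots> \<le> emeasure P (space P)"
      by (rule emeasure_space)
    finally show "emeasure (distr P borel T) UNIV \<noteq> 0"
      by (auto simp: emeasure_distr)
    fix r
    define R where "R = \<bar>r\<bar> + norm a"
    have "emeasure (distr P borel T) (cball 0 r) = emeasure P (T -` cball 0 r \<inter> space P)"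
      by (simp add: emeasure_distr)
    also have "\<dots> \<le> emeasure P (Pi\<^sub>E B (\<lambda>_. {-R..R}))"
    proof (rule emeasure_mono)
      show "T -` cball 0 r \<inter> space P \<subseteq> Pi\<^sub>E B (\<lambda>_. {-R..R})"
      proof
        fix c assume c: "c \<in> T -` cball 0 r \<inter> space P"
        have "c b \<in> {-R..R}" if "b \<in> B" for b
        proof -
          have "\<bar>c b\<bar> \<le> norm (T c - a)"
            using Cauchy_Schwarz_ineq2[of "T c - a" b] coord[OF that, of c] nrm[OF that] by simp
          also have "\<dots> \<le> R" using norm_triangle_ineq4[of "T c" a] c by (auto simp: R_def)
          finally show ?thesis by auto
        qed
        then show "c \<in> Pi\<^sub>E B (\<lambda>_. {-R..R})" using c unfolding sp by (auto simp: PiE_iff)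
      qed
      show "Pi\<^sub>E B (\<lambda>_. {-R..R}) \<in> sets P" unfolding P_def by (intro sets_PiM_I_finite) auto
    qed
    also have "\<dots> < \<infinity>"
      by (subst Pi) (auto simp: emeasure_lborel_Icc_eq power_less_top_ennreal)
    finally show "emeasure (distr P borel T) (cball 0 r) < \<infinity>" .
  next
    fix u v assume "u \<in> A" "v \<in> A"
    then have "u - v \<in> span B" unfolding span by auto
    then obtain d where d: "u - v = (\<Sum>b\<in>B. d b *\<^sub>R b)"
      unfolding span_finite[OF fin] by blast
    define \<sigma> where "\<sigma> c = (\<lambda>b\<in>B. c b + d b)" for c :: "'a \<Rightarrow> real"
    have [measurable]: "\<sigma> \<in> P \<rightarrow>\<^sub>M P"
    proof -
      have "\<sigma> \<in> P \<rightarrow>\<^sub>M (\<Pi>\<^sub>M b\<in>B. (lborel :: real measure))"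
        unfolding \<sigma>_def by (rule measurable_restrict) simp
      then show ?thesis by (simp add: P_def)
    qed
    have inv: "distr P P \<sigma> = P"
    proof -
      have "distr P P \<sigma> = (\<Pi>\<^sub>M b\<in>B. (lborel :: real measure))"
      proof (rule PiM_eqI)
        fix X :: "'a \<Rightarrow> real set" assume X: "\<And>b. b \<in> B \<Longrightarrow> X b \<in> sets lborel"
        have "Pi\<^sub>E B X \<in> sets P" unfolding P_def using X by (intro sets_PiM_I_finite) auto
        then have "emeasure (distr P P \<sigma>) (Pi\<^sub>E B X) = emeasure P (\<sigma> -` Pi\<^sub>E B X \<inter> space P)"
          by (simp add: emeasure_distr)
        also have "\<sigma> -` Pi\<^sub>E B X \<inter> space P = Pi\<^sub>E B (\<lambda>b. (\<lambda>t. d b + t) -` X b)"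
          unfolding sp by (auto simp: \<sigma>_def PiE_iff add.commute)
        also have "emeasure P \<dots> = (\<Prod>b\<in>B. emeasure lborel ((\<lambda>t. d b + t) -` X b))"
        proof (rule Pi)
          fix b assume "b \<in> B"
          then show "(\<lambda>t. d b + t) -` X b \<in> sets borel"
            using X measurable_sets[of "\<lambda>t. d b + t" borel borel "X b"] by simp
        qed
        also have "\<dots> = (\<Prod>b\<in>B. emeasure lborel (X b))"
        proof (rule prod.cong[OF refl])
          fix b assume "b \<in> B"
          then have "emeasure (distr lborel borel (\<lambda>t. d b + t)) (X b) = emeasure lborel ((\<lambda>t. d b + t) -` X b)"
            using X by (simp add: emeasure_distr)
          then show "emeasure lborel ((\<lambda>t. d b + t) -` X b) = emeasure lborel (X b)"
            by (simp add: lborel_distr_plus)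
        qed
        finally show "emeasure (distr P P \<sigma>) (Pi\<^sub>E B X) = (\<Prod>b\<in>B. emeasure lborel (X b))" .
      qed (auto simp: P_def)
      then show ?thesis by (simp add: P_def)
    qed
    have "distr (distr P borel T) borel (\<lambda>x. x + (u - v)) = distr P borel (\<lambda>c. T c + (u - v))"
      by (subst distr_distr) (auto simp: o_def)
    also have "(\<lambda>c. T c + (u - v)) = T \<circ> \<sigma>"
      by (auto simp: fun_eq_iff T_def \<sigma>_def d sum.distrib scaleR_left_distrib)
    also have "distr P borel \<dots> = distr (distr P P \<sigma>) borel T"
      by (subst distr_distr) auto
    finally show "distr (distr P borel T) borel (\<lambda>x. x + (u - v)) = distr P borel T"
      by (simp add: inv)
  qed simp
  then show ?thesis unfolding P_def T_def .
qed

text \<open>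
  \<^const>\<open>affine_lebesgue\<close> without the completion: the Borel measure to which the uniqueness of
  Haar measures applies.
\<close>

definition flat_lebesgue :: "'a::euclidean_space set \<Rightarrow> 'a measure" where
  "flat_lebesgue A =
     (let a = (SOME a. a \<in> A);
          B = (SOME B. orthonormal_basis_of {u - v | u v. u \<in> A \<and> v \<in> A} B)
      in distr (\<Pi>\<^sub>M b\<in>B. (lborel :: real measure)) borel (\<lambda>c. a + (\<Sum>b\<in>B. c b *\<^sub>R b)))"

lemma affine_lebesgue_eq_completion: "affine_lebesgue A = completion (flat_lebesgue A)"
  unfolding affine_lebesgue_def flat_lebesgue_def Let_def ..

lemma haar_on_flat_lebesgue:
  assumes "affine A" "A \<noteq> {}" shows "haar_on A (flat_lebesgue A)"
proof -
  define D where "D = {u - v | u v. u \<in> A \<and> v \<in> A}"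
  obtain a0 where a0: "a0 \<in> A" using assms by blast
  have "D = (\<lambda>x. x - a0) ` A"
  proof
    show "D \<subseteq> (\<lambda>x. x - a0) ` A"
    proof
      fix d assume "d \<in> D"
      then obtain u v where "d = u - v" "u \<in> A" "v \<in> A" unfolding D_def by auto
      then show "d \<in> (\<lambda>x. x - a0) ` A"
        using mem_affine_3_minus[OF assms(1) a0, of u v 1] by (auto intro: image_eqI[of _ _ "a0 + (u - v)"])
    qed
  qed (use a0 in \<open>auto simp: D_def\<close>)
  then have "subspace D" using affine_diffs_subspace_subtract[OF assms(1) a0] by simp
  then obtain B where "orthonormal_basis_of D B"
    using orthonormal_basis_subspace[of D] unfolding orthonormal_basis_of_def by metis
  then have B: "orthonormal_basis_of D (SOME B. orthonormal_basis_of D B)" by (rule someI)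
  have a: "(SOME a. a \<in> A) \<in> A" using a0 by (rule someI)
  show ?thesis
    unfolding flat_lebesgue_def Let_def
    by (rule haar_on_orthonormal[OF B[unfolded D_def] assms(1) a])
qed

text \<open>
  A convex set contains a relative neighbourhood of some point. Were it null, so would be all the
  translates of this neighbourhood inside the affine hull, and countably many of them cover the
  affine hull by Lindeloef's theorem.
\<close>

lemma haar_on_convex_positive:
  fixes S :: "'a::euclidean_space set"
  assumes \<mu>: "haar_on (affine hull S) \<mu>" and S: "convex S" "S \<noteq> {}" "S \<in> sets borel"
  shows "emeasure \<mu> S \<noteq> 0"
proof
  assume 0: "emeasure \<mu> S = 0"
  let ?A = "affine hull S"
  note s = haar_onD(1,2)[OF \<mu>]
  obtain a where "a \<in> rel_interior S" using S rel_interior_eq_empty by blast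
  then have "a \<in> S" and "\<exists>e>0. cball a e \<inter> ?A \<subseteq> S"
    unfolding mem_rel_interior_cball by simp_all
  then obtain e where a: "a \<in> ?A" and e: "e > 0" "cball a e \<inter> ?A \<subseteq> S"
    by (auto intro: hull_inc)
  obtain D where D: "countable D" "D \<subseteq> ?A" "?A \<subseteq> (\<Union>d\<in>D. ball d e)"
  proof -
    obtain \<F> where "\<F> \<subseteq> (\<lambda>d. ball d e) ` ?A" "countable \<F>" "\<Union>\<F> = \<Union>((\<lambda>d. ball d e) ` ?A)"
      by (rule Lindelof[of "(\<lambda>d. ball d e) ` ?A"]) auto
    then have "\<exists>\<F>. countable \<F> \<and> \<F> \<subseteq> (\<lambda>d. ball d e) ` ?A \<and> \<Union>\<F> = \<Union>((\<lambda>d. ball d e) ` ?A)"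
      by (intro exI[of _ \<F>] conjI)
    then obtain D where "countable D" "D \<subseteq> ?A" "\<Union>((\<lambda>d. ball d e) ` D) = \<Union>((\<lambda>d. ball d e) ` ?A)"
      unfolding ex_countable_subset_image by (elim exE conjE)
    moreover have "?A \<subseteq> (\<Union>d\<in>?A. ball d e)"
    proof
      fix x assume "x \<in> ?A"
      moreover have "x \<in> ball x e" using e(1) by simp
      ultimately show "x \<in> (\<Union>d\<in>?A. ball d e)" by (rule UN_I)
    qed
    ultimately show thesis using that by simp
  qed
  have n: "AE x in \<mu>. x \<notin> cball d e \<inter> ?A" if d: "d \<in> ?A" for d
  proof -
    have b[measurable]: "cball z e \<inter> ?A \<in> sets borel" for z by simp
    have "emeasure \<mu> (cball d e \<inter> ?A) = (\<integral>\<^sup>+x. indicator (cball d e \<inter> ?A) x \<partial>\<mu>)"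
      using b s by simp
    also have "\<dots> = (\<integral>\<^sup>+x. indicator (cball a e \<inter> ?A) (x + (a - d)) \<partial>\<mu>)"
    proof (rule nn_integral_cong)
      fix x
      have "x + (a - d) \<in> ?A \<longleftrightarrow> x \<in> ?A"
        using mem_affine_3_minus[OF affine_affine_hull _ a d, of x 1]
          mem_affine_3_minus[OF affine_affine_hull _ d a, of "x + (a - d)" 1]
        by (auto)
      then show "indicator (cball d e \<inter> ?A) x = (indicator (cball a e \<inter> ?A) (x + (a - d)) :: ennreal)"
        by (auto simp: indicator_def dist_norm algebra_simps)
    qed
    also have "\<dots> = (\<integral>\<^sup>+x. indicator (cball a e \<inter> ?A) x \<partial>\<mu>)"
      by (rule haar_on_nn_integral_translate[OF \<mu> a d]) simp
    also have "\<dots> = emeasure \<mu> (cball a e \<inter> ?A)" using b s by simp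
    also have "\<dots> \<le> emeasure \<mu> S" using e S(3) s by (intro emeasure_mono) auto
    finally have "cball d e \<inter> ?A \<in> null_sets \<mu>" using 0 b s by (intro null_setsI) auto
    then show ?thesis by (rule AE_not_in)
  qed
  have "AE x in \<mu>. \<forall>d\<in>D. x \<notin> cball d e \<inter> ?A"
    using n D(2) by (subst AE_ball_countable[OF D(1)]) (simp add: subset_iff)
  with haar_onD(3)[OF \<mu>] have "AE x in \<mu>. False"
  proof eventually_elim
    case (elim x)
    then obtain d where "d \<in> D" "dist d x < e"
      using D(3) by (auto simp: subset_iff)
    then have "x \<in> cball d e \<inter> ?A" using elim(1) by (simp add: less_imp_le)
    then show ?case using elim(2) \<open>d \<in> D\<close> by blast
  qed
  then have "emeasure \<mu> (space \<mu>) = 0"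
    by (simp add: AE_iff_null_sets null_setsD1)
  then show False using haar_onD(2,4)[OF \<mu>] by simp
qed

section \<open>Uniform distributions on convex bodies\<close>

lemma affine_hull_affine_image:
  fixes \<phi> :: "'a::euclidean_space \<Rightarrow> 'b::euclidean_space"
  assumes M: "linear M" and \<phi>: "\<And>z. \<phi> z = c + M z"
  shows "affine hull (\<phi> ` S) = \<phi> ` (affine hull S)"
proof -
  have \<phi>': "\<phi> ` X = (+) c ` M ` X" for X by (auto simp: \<phi> image_image)
  show ?thesis unfolding \<phi>' affine_hull_translation
    using M affine_hull_linear_image linear_conv_bounded_linear by metis
qed

lemma convex_hull_affine_image:
  assumes M: "linear M" and \<phi>: "\<And>z. \<phi> z = c + M z"
  shows "convex hull (\<phi> ` S) = \<phi> ` (convex hull S)"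
proof -
  have \<phi>': "\<phi> ` X = (+) c ` M ` X" for X by (auto simp: \<phi> image_image)
  show ?thesis unfolding \<phi>' convex_hull_translation
    using M convex_hull_linear_image by metis
qed

text \<open>
  Compactness makes the volume relative to the affine hull finite; convexity and nonemptiness make it
  positive.
\<close>

definition convex_body :: "'a::euclidean_space set \<Rightarrow> bool" where
  "convex_body S \<longleftrightarrow> compact S \<and> convex S \<and> S \<noteq> {}"

lemma convex_body_affine_image:
  fixes \<phi> :: "'a::euclidean_space \<Rightarrow> 'b::euclidean_space"
  assumes "linear M" and \<phi>: "\<And>z. \<phi> z = c + M z" and S: "convex_body S"
  shows "convex_body (\<phi> ` S)"
proof -
  have \<phi>': "\<phi> ` S = (+) c ` M ` S" by (auto simp: \<phi> image_image)
  have "convex (\<phi> ` S)" unfolding \<phi>'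
    using S assms(1) convex_linear_image convex_translation convex_body_def by blast
  moreover have "compact (\<phi> ` S)" unfolding \<phi>'
    using S assms(1) compact_continuous_image linear_continuous_on linear_conv_bounded_linear
      compact_translation convex_body_def by metis
  ultimately show ?thesis using S by (simp add: convex_body_def)
qed

lemma convex_body_convex_hull:
  assumes "finite W" "W \<noteq> {}" shows "convex_body (convex hull W)"
  using assms by (simp add: convex_body_def finite_imp_compact_convex_hull)

lemma convex_body_borel: "convex_body S \<Longrightarrow> S \<in> sets borel"
  by (simp add: convex_body_def borel_compact)

lemma haar_on_convex_body:
  assumes "convex_body S" "haar_on (affine hull S) \<mu>"
  shows "emeasure \<mu> S \<noteq> 0" "emeasure \<mu> S \<noteq> \<infinity>"
proof -
  show "emeasure \<mu> S \<noteq> 0"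
    using haar_on_convex_positive[OF assms(2)] assms(1) convex_body_borel[OF assms(1)] by (auto simp: convex_body_def)
  show "emeasure \<mu> S \<noteq> \<infinity>"
    using haar_on_bounded[OF assms(2), of S] assms(1) by (auto simp: convex_body_def compact_imp_bounded)
qed

definition uniform_on :: "'a::euclidean_space set \<Rightarrow> 'a measure" where
  "uniform_on S = uniform_measure (flat_lebesgue (affine hull S)) S"

lemma haar_on_flat_lebesgue_hull:
  "convex_body S \<Longrightarrow> haar_on (affine hull S) (flat_lebesgue (affine hull S))"
  by (rule haar_on_flat_lebesgue) (auto simp: convex_body_def)

text \<open>
  The scaling constant between two Haar measures cancels in the quotient, so any of them may be
  used to compute the uniform distribution.
\<close>

lemma uniform_on_eq:
  assumes S: "convex_body S" and \<mu>: "haar_on (affine hull S) \<mu>"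
  shows "uniform_on S = uniform_measure \<mu> S"
proof (rule measure_eqI)
  let ?\<nu> = "flat_lebesgue (affine hull S)"
  have \<nu>: "haar_on (affine hull S) ?\<nu>" by (rule haar_on_flat_lebesgue_hull[OF S])
  note s = haar_onD(1)[OF \<mu>] haar_onD(1)[OF \<nu>] convex_body_borel[OF S]
  show "sets (uniform_on S) = sets (uniform_measure \<mu> S)"
    using s by (simp add: uniform_on_def)
  fix X assume "X \<in> sets (uniform_on S)"
  then have X: "X \<in> sets borel" using s by (simp add: uniform_on_def)
  obtain c where c: "c \<noteq> 0" "c \<noteq> \<infinity>" "\<And>X. X \<in> sets borel \<Longrightarrow> emeasure ?\<nu> X = c * emeasure \<mu> X"
    using haar_on_unique[OF \<nu> \<mu>] by blast
  have "emeasure (uniform_on S) X = c * emeasure \<mu> (S \<inter> X) / (c * emeasure \<mu> S)"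
    using s X c(3) by (simp add: uniform_on_def)
  also have "\<dots> = emeasure \<mu> (S \<inter> X) / emeasure \<mu> S"
    unfolding mult.commute[of c] using c(1,2) by (rule divide_mult_eq)
  also have "\<dots> = emeasure (uniform_measure \<mu> S) X"
    using s X by simp
  finally show "emeasure (uniform_on S) X = emeasure (uniform_measure \<mu> S) X" .
qed

lemma sets_uniform_on: "convex_body S \<Longrightarrow> sets (uniform_on S) = sets borel"
  using haar_onD(1)[OF haar_on_flat_lebesgue_hull[of S]] by (simp add: uniform_on_def)

lemma prob_space_uniform_on:
  assumes "convex_body S" shows "prob_space (uniform_on S)"
  unfolding uniform_on_def using haar_on_convex_body[OF assms haar_on_flat_lebesgue_hull[OF assms]]
  by (rule prob_space_uniform_measure)

lemma AE_uniform_on: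
  assumes "convex_body S" shows "AE x in uniform_on S. x \<in> S"
  unfolding uniform_on_def
  using convex_body_borel[OF assms] haar_onD(1)[OF haar_on_flat_lebesgue_hull[OF assms]]
  by (intro AE_uniform_measureI) auto

text \<open>
  The image of a Haar measure under an injective affine map is again one, so normalisation makes
  the uniform distribution equivariant, whatever the factor by which \<open>\<phi>\<close> scales volumes.
\<close>

lemma uniform_on_affine_image:
  fixes \<phi> :: "'a::euclidean_space \<Rightarrow> 'b::euclidean_space"
  assumes S: "convex_body S" and M: "linear M" and \<phi>: "\<And>z. \<phi> z = c + M z"
    and inj: "inj_on \<phi> (affine hull S)"
  shows "uniform_on (\<phi> ` S) = distr (uniform_on S) borel \<phi>"
proof (rule measure_eqI)
  let ?A = "affine hull S" and ?\<mu> = "flat_lebesgue (affine hull S)"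
  have \<mu>: "haar_on ?A ?\<mu>" by (rule haar_on_flat_lebesgue_hull[OF S])
  have S': "convex_body (\<phi> ` S)" by (rule convex_body_affine_image[OF M \<phi> S])
  have \<nu>: "haar_on (affine hull (\<phi> ` S)) (distr ?\<mu> borel \<phi>)"
    unfolding affine_hull_affine_image[OF M \<phi>]
    by (rule haar_on_affine_image[OF \<mu> M \<phi> inj affine_affine_hull])
  note s[simp] = haar_onD(1,2)[OF \<mu>] convex_body_borel[OF S] convex_body_borel[OF S'] sets_uniform_on[OF S] sets_uniform_on[OF S']
  have [measurable_cong]: "sets ?\<mu> = sets borel" by simp
  have "M \<in> borel_measurable borel"
    using M by (intro borel_measurable_continuous_onI linear_continuous_on) (simp add: linear_conv_bounded_linear)
  then have \<phi>m[measurable]: "\<phi> \<in> borel_measurable borel" unfolding \<phi> by measurable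
  then have \<phi>m'[measurable]: "\<phi> \<in> borel_measurable ?\<mu>" by measurable
  have vim: "\<phi> -` X \<in> sets borel" if "X \<in> sets borel" for X
    using measurable_sets[OF \<phi>m that] by simp
  show "sets (uniform_on (\<phi> ` S)) = sets (distr (uniform_on S) borel \<phi>)" by simp
  have eq: "emeasure ?\<mu> (\<phi> -` (\<phi> ` S) \<inter> Y) = emeasure ?\<mu> (S \<inter> Y)" if Y: "Y \<in> sets borel" for Y
  proof (rule emeasure_eq_AE)
    show "AE x in ?\<mu>. (x \<in> \<phi> -` (\<phi> ` S) \<inter> Y) = (x \<in> S \<inter> Y)"
      using haar_onD(3)[OF \<mu>]
    proof eventually_elim
      case (elim x)
      have "x \<in> S" if "\<phi> x = \<phi> y" "y \<in> S" for y
        using inj_onD[OF inj that(1) elim] that(2) hull_inc by metis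
      then show ?case by auto
    qed
  qed (use Y vim in auto)
  fix X assume "X \<in> sets (uniform_on (\<phi> ` S))"
  then have X: "X \<in> sets borel" by simp
  have "emeasure (uniform_on (\<phi> ` S)) X = emeasure (distr ?\<mu> borel \<phi>) (\<phi> ` S \<inter> X) / emeasure (distr ?\<mu> borel \<phi>) (\<phi> ` S)"
    unfolding uniform_on_eq[OF S' \<nu>] using X by (subst emeasure_uniform_measure) auto
  also have "emeasure (distr ?\<mu> borel \<phi>) (\<phi> ` S \<inter> X) = emeasure ?\<mu> (S \<inter> \<phi> -` X)"
    using X eq[of "\<phi> -` X"] vim[OF X] by (subst emeasure_distr) auto
  also have "emeasure (distr ?\<mu> borel \<phi>) (\<phi> ` S) = emeasure ?\<mu> S"
    using eq[of UNIV] by (subst emeasure_distr) auto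
  also have "emeasure ?\<mu> (S \<inter> \<phi> -` X) / emeasure ?\<mu> S = emeasure (uniform_on S) (\<phi> -` X)"
    unfolding uniform_on_def using vim[OF X] by (subst emeasure_uniform_measure) auto
  also have "\<dots> = emeasure (distr (uniform_on S) borel \<phi>) X"
  proof -
    have "space (uniform_on S) = UNIV" using sets_eq_imp_space_eq[OF sets_uniform_on[OF S]] by simp
    moreover have "\<phi> \<in> uniform_on S \<rightarrow>\<^sub>M borel"
      using \<phi>m measurable_cong_sets[OF sets_uniform_on[OF S] refl] by blast
    ultimately show ?thesis using X by (simp add: emeasure_distr)
  qed
  finally show "emeasure (uniform_on (\<phi> ` S)) X = emeasure (distr (uniform_on S) borel \<phi>) X" .
qed

section \<open>The uniform distribution on a cone\<close>

lemma convex_body_cone: "convex_body F \<Longrightarrow> convex_body (convex hull (insert v F))"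
  by (simp add: convex_body_def compact_convex_hull)

text \<open>
  If the two heights \<open>\<tau>\<close> and \<open>u\<close> differed, the equation could be solved for \<open>v\<close>, which would
  become an affine combination of points of \<open>A\<close>.
\<close>

lemma cone_height_unique:
  assumes A: "affine A" and m: "y \<in> A" "b \<in> A" "q \<in> A" and v: "v \<notin> A"
    and eq: "\<tau> *\<^sub>R (v - q) + y = u *\<^sub>R v + (1 - u) *\<^sub>R b"
  shows "\<tau> = u" "y = \<tau> *\<^sub>R q + (1 - \<tau>) *\<^sub>R b"
proof -
  show "\<tau> = u"
  proof (rule ccontr)
    assume ne: "\<tau> \<noteq> u"
    define d where "d = 1 / (\<tau> - u)"
    have d: "d * (\<tau> - u) = 1" using ne by (simp add: d_def)
    have "(\<tau> - u) *\<^sub>R v = (1 - u) *\<^sub>R b + \<tau> *\<^sub>R q - y" using eq by (simp add: algebra_simps)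
    then have "d *\<^sub>R ((\<tau> - u) *\<^sub>R v) = d *\<^sub>R ((1 - u) *\<^sub>R b + \<tau> *\<^sub>R q - y)" by simp
    then have "v = (d * (1 - u)) *\<^sub>R b + (d * \<tau>) *\<^sub>R q + (- d) *\<^sub>R y"
      using d by (simp add: algebra_simps)
    moreover have "d * (1 - u) + d * \<tau> + (- d) = 1" using d by (simp add: algebra_simps)
    ultimately have "v \<in> A" using mem_affine_3[OF A m(2,3,1)] by metis
    then show False using v by blast
  qed
  then show "y = \<tau> *\<^sub>R q + (1 - \<tau>) *\<^sub>R b" using eq by (simp add: algebra_simps)
qed

text \<open>
  Slice the cone parallel to its base \<open>F\<close>. The slice at height \<open>\<tau>\<close> is a homothetic copy of
  \<open>F\<close>, so a point chosen uniformly from the slice is \<open>\<tau> *\<^sub>R v + (1 - \<tau>) *\<^sub>R y\<close> with \<open>y\<close> uniform on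
  \<open>F\<close>. Hence in a uniform point of the cone the height \<open>\<tau>\<close> and the projection \<open>y\<close> of the point
  from the apex to the base are independent. The density of the law \<open>\<rho>\<close> of \<open>\<tau>\<close> is
  proportional to the measure \<open>H \<tau>\<close> of the slice.
\<close>

lemma uniform_on_cone:
  fixes F :: "'a::euclidean_space set"
  assumes F: "convex_body F" and v: "v \<notin> affine hull F"
  obtains \<rho> :: "real measure" where "prob_space \<rho>" "sets \<rho> = sets borel" "AE \<tau> in \<rho>. 0 < \<tau> \<and> \<tau> < 1"
    "uniform_on (convex hull (insert v F)) =
       distr (\<rho> \<Otimes>\<^sub>M uniform_on F) borel (\<lambda>(\<tau>, y). \<tau> *\<^sub>R v + (1 - \<tau>) *\<^sub>R y)"
proof -
  define A where "A = affine hull F"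
  define S where "S = convex hull (insert v F)"
  define \<mu>' where "\<mu>' = flat_lebesgue A"
  define U where "U = uniform_on F"
  have \<mu>': "haar_on A \<mu>'" unfolding \<mu>'_def A_def by (rule haar_on_flat_lebesgue_hull[OF F])
  have A: "affine A" by (simp add: A_def)
  have vA: "v \<notin> A" using v by (simp add: A_def)
  obtain q where qF: "q \<in> F" using F by (auto simp: convex_body_def)
  have FA: "F \<subseteq> A" unfolding A_def by (rule hull_subset)
  have q: "q \<in> A" using qF FA by blast
  let ?P = "(lborel :: real measure) \<Otimes>\<^sub>M \<mu>'"
  define \<Psi> where "\<Psi> = (\<lambda>(\<tau>::real, y). \<tau> *\<^sub>R (v - q) + y)"
  define \<mu> where "\<mu> = distr ?P borel \<Psi>"
  have S: "convex_body S" unfolding S_def by (rule convex_body_cone[OF F])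
  have Sb[measurable]: "S \<in> sets borel" by (rule convex_body_borel[OF S])
  have hS: "affine hull (insert v A) = affine hull S"
    unfolding A_def S_def by (simp flip: hull_insert)
  have \<mu>: "haar_on (affine hull S) \<mu>"
    using haar_on_affine_hull_insert[OF \<mu>' A q vA] unfolding hS \<mu>_def \<Psi>_def .
  have [measurable_cong]: "sets \<mu>' = sets borel" "sets U = sets borel"
    using haar_onD(1)[OF \<mu>'] sets_uniform_on[OF F] by (simp_all add: U_def)
  interpret M: sigma_finite_measure \<mu>' by (rule haar_on_sigma_finite[OF \<mu>'])
  interpret U: prob_space U unfolding U_def by (rule prob_space_uniform_on[OF F])
  have \<Psi>b[measurable]: "\<Psi> \<in> borel \<Otimes>\<^sub>M borel \<rightarrow>\<^sub>M borel" unfolding \<Psi>_def by measurable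
  have \<Psi>P[measurable]: "\<Psi> \<in> ?P \<rightarrow>\<^sub>M borel" unfolding \<Psi>_def by measurable
  have US: "uniform_on S = uniform_measure \<mu> S" by (rule uniform_on_eq[OF S \<mu>])
  have \<mu>S: "emeasure \<mu> S \<noteq> 0" "emeasure \<mu> S \<noteq> \<infinity>" using haar_on_convex_body[OF S \<mu>] .
  have s\<mu>: "sets \<mu> = sets borel" by (simp add: \<mu>_def)
  define \<theta> where "\<theta> \<tau> y = \<tau> *\<^sub>R q + (1 - \<tau>) *\<^sub>R y" for \<tau> y
  define H where "H \<tau> = indicator {0<..<1} \<tau> * (\<integral>\<^sup>+y. indicator S (\<Psi> (\<tau>, y)) \<partial>\<mu>')" for \<tau>
  have Hm[measurable]: "H \<in> borel_measurable borel" unfolding H_def by measurable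
  \<comment> \<open>the slice at height \<open>\<tau>\<close>, in the coordinates of \<open>\<Psi>\<close>, is \<open>\<theta> \<tau> ` F\<close>, and there is none
    outside \<open>0 \<le> \<tau> \<le> 1\<close>\<close>
  have inS: "\<exists>b\<in>F. y = \<theta> \<tau> b \<and> 0 \<le> \<tau> \<and> \<tau> \<le> 1" if "\<Psi> (\<tau>, y) \<in> S" "y \<in> A" for \<tau> y
  proof -
    have "F \<noteq> {}" "convex hull F = F" using F by (auto simp: convex_body_def convex_hull_eq)
    with that(1) obtain u w b where ub: "0 \<le> u" "0 \<le> w" "u + w = 1" "b \<in> F" "\<Psi> (\<tau>, y) = u *\<^sub>R v + w *\<^sub>R b"
      unfolding S_def by (auto simp: convex_hull_insert)
    have w: "w = 1 - u" using ub by simp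
    have b: "b \<in> A" using ub FA by blast
    have e: "\<tau> *\<^sub>R (v - q) + y = u *\<^sub>R v + (1 - u) *\<^sub>R b" using ub(5) w by (simp add: \<Psi>_def)
    show ?thesis
      using cone_height_unique[OF A that(2) b q vA e] ub(1,2,4) w by (auto simp: \<theta>_def)
  qed
  have \<Psi>\<theta>: "\<Psi> (\<tau>, \<theta> \<tau> y) = \<tau> *\<^sub>R v + (1 - \<tau>) *\<^sub>R y" for \<tau> y
    by (simp add: \<Psi>_def \<theta>_def algebra_simps)
  have inS': "\<Psi> (\<tau>, \<theta> \<tau> b) \<in> S" if "b \<in> F" "0 \<le> \<tau>" "\<tau> \<le> 1" for \<tau> b
  proof -
    have "v \<in> S" "b \<in> S" using that(1) unfolding S_def by (auto intro: hull_inc)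
    moreover have "convex S" by (simp add: S_def)
    ultimately show ?thesis using that(2,3) unfolding \<Psi>\<theta> by (intro convexD) auto
  qed
  define K where "K X \<tau> = (\<integral>\<^sup>+y. indicator X (\<tau> *\<^sub>R v + (1 - \<tau>) *\<^sub>R y) \<partial>U)" for X \<tau>
  have Km[measurable]: "K X \<in> borel_measurable borel" if [measurable]: "X \<in> sets borel" for X
    unfolding K_def by measurable
  \<comment> \<open>the heights \<open>0\<close> and \<open>1\<close> form a null set; at the apex the map \<open>\<theta> 1\<close> is not injective\<close>
  have slice: "(\<integral>\<^sup>+y. indicator S (\<Psi> (\<tau>, y)) * indicator X (\<Psi> (\<tau>, y)) \<partial>\<mu>') = H \<tau> * K X \<tau>"
    if X[measurable]: "X \<in> sets borel" and \<tau>: "\<tau> \<noteq> 0" "\<tau> \<noteq> 1" for X \<tau>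
  proof (cases "0 < \<tau> \<and> \<tau> < 1")
    case False
    have "(\<integral>\<^sup>+y. indicator S (\<Psi> (\<tau>, y)) * indicator X (\<Psi> (\<tau>, y)) \<partial>\<mu>') = (\<integral>\<^sup>+y. 0 \<partial>\<mu>')"
    proof (rule nn_integral_cong_AE, use haar_onD(3)[OF \<mu>'] in eventually_elim)
      case (elim y)
      have "\<Psi> (\<tau>, y) \<notin> S" using inS[of \<tau> y] elim False \<tau> by auto
      then show ?case by simp
    qed
    then show ?thesis using False by (simp add: H_def)
  next
    case True
    have lin: "linear (\<lambda>y. (1 - \<tau>) *\<^sub>R y)" by (rule linear_scaleR)
    have \<theta>a: "\<theta> \<tau> y = \<tau> *\<^sub>R q + (1 - \<tau>) *\<^sub>R y" for y by (simp add: \<theta>_def)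
    have inj: "inj_on (\<theta> \<tau>) X" for X using True by (auto simp: inj_on_def \<theta>_def)
    have \<theta>A: "\<theta> \<tau> ` A = A"
    proof
      show "\<theta> \<tau> ` A \<subseteq> A" unfolding \<theta>_def using mem_affine[OF A q] by auto
      show "A \<subseteq> \<theta> \<tau> ` A"
      proof
        fix z assume z: "z \<in> A"
        let ?y = "(1 / (1 - \<tau>)) *\<^sub>R z + (- \<tau> / (1 - \<tau>)) *\<^sub>R q"
        have "1 / (1 - \<tau>) + (- \<tau> / (1 - \<tau>)) = 1" using True by (simp add: field_simps)
        then have "?y \<in> A" by (rule mem_affine[OF A z q])
        moreover have "\<theta> \<tau> ?y = z" using True by (simp add: \<theta>_def scaleR_right_diff_distrib)
        ultimately show "z \<in> \<theta> \<tau> ` A" by (metis imageI)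
      qed
    qed
    have hF: "affine hull (\<theta> \<tau> ` F) = A"
      using affine_hull_affine_image[OF lin \<theta>a] \<theta>A by (simp add: A_def)
    have bF: "convex_body (\<theta> \<tau> ` F)" by (rule convex_body_affine_image[OF lin \<theta>a F])
    have [measurable]: "\<theta> \<tau> ` F \<in> sets borel" by (rule convex_body_borel[OF bF])
    \<comment> \<open>the homothety preserves \<open>A\<close>, so \<open>\<mu>'\<close> also serves to describe the uniform distribution on the slice\<close>
    have h\<mu>: "haar_on (affine hull (\<theta> \<tau> ` F)) \<mu>'" using \<mu>' hF by simp
    note pos = haar_on_convex_body[OF bF h\<mu>]
    have ind: "AE y in \<mu>'. indicator S (\<Psi> (\<tau>, y)) = (indicator (\<theta> \<tau> ` F) y :: ennreal)"
      using haar_onD(3)[OF \<mu>']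
    proof eventually_elim
      case (elim y)
      have "\<Psi> (\<tau>, y) \<in> S \<longleftrightarrow> y \<in> \<theta> \<tau> ` F"
        using inS[of \<tau> y] elim inS'[of _ \<tau>] True by auto
      then show ?case by (simp add: indicator_def)
    qed
    have H: "H \<tau> = emeasure \<mu>' (\<theta> \<tau> ` F)"
    proof -
      have "H \<tau> = (\<integral>\<^sup>+y. indicator (\<theta> \<tau> ` F) y \<partial>\<mu>')"
        unfolding H_def using True ind by (simp cong: nn_integral_cong_AE)
      then show ?thesis by simp
    qed
    have "(\<integral>\<^sup>+y. indicator S (\<Psi> (\<tau>, y)) * indicator X (\<Psi> (\<tau>, y)) \<partial>\<mu>')
        = (\<integral>\<^sup>+y. indicator X (\<Psi> (\<tau>, y)) * indicator (\<theta> \<tau> ` F) y \<partial>\<mu>')"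
      by (rule nn_integral_cong_AE, use ind in eventually_elim) (simp add: mult.commute)
    also have "\<dots> = H \<tau> * ((\<integral>\<^sup>+y. indicator X (\<Psi> (\<tau>, y)) * indicator (\<theta> \<tau> ` F) y \<partial>\<mu>') / H \<tau>)"
      using pos unfolding H by (simp add: ennreal_times_divide ennreal_mult_divide_eq mult.commute[of "emeasure _ _"])
    also have "(\<integral>\<^sup>+y. indicator X (\<Psi> (\<tau>, y)) * indicator (\<theta> \<tau> ` F) y \<partial>\<mu>') / H \<tau>
        = (\<integral>\<^sup>+y. indicator X (\<Psi> (\<tau>, y)) \<partial>uniform_measure \<mu>' (\<theta> \<tau> ` F))"
      unfolding H by (rule nn_integral_uniform_measure[symmetric]) measurable
    also have "uniform_measure \<mu>' (\<theta> \<tau> ` F) = distr U borel (\<theta> \<tau>)"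
      unfolding uniform_on_eq[OF bF h\<mu>, symmetric] U_def by (rule uniform_on_affine_image[OF F lin \<theta>a inj])
    also have "(\<integral>\<^sup>+y. indicator X (\<Psi> (\<tau>, y)) \<partial>distr U borel (\<theta> \<tau>)) = K X \<tau>"
    proof -
      have [measurable]: "\<theta> \<tau> \<in> borel_measurable borel" unfolding \<theta>a by measurable
      have "(\<integral>\<^sup>+y. indicator X (\<Psi> (\<tau>, y)) \<partial>distr U borel (\<theta> \<tau>)) = (\<integral>\<^sup>+y. indicator X (\<Psi> (\<tau>, \<theta> \<tau> y)) \<partial>U)"
        by (rule nn_integral_distr) measurable
      then show ?thesis by (simp add: K_def \<Psi>\<theta>)
    qed
    finally show ?thesis .
  qed
  define \<rho> where "\<rho> = density lborel (\<lambda>\<tau>. H \<tau> / emeasure \<mu> S)"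
  have s\<rho>[measurable_cong]: "sets \<rho> = sets borel" by (simp add: \<rho>_def)
  have em: "emeasure (uniform_on S) X = (\<integral>\<^sup>+\<tau>. K X \<tau> \<partial>\<rho>)" if X[measurable]: "X \<in> sets borel" for X
  proof -
    have "emeasure (uniform_on S) X = emeasure \<mu> (S \<inter> X) / emeasure \<mu> S"
      unfolding US using s\<mu> by (subst emeasure_uniform_measure) auto
    also have "emeasure \<mu> (S \<inter> X) = (\<integral>\<^sup>+x. indicator S x * indicator X x \<partial>\<mu>)"
      using s\<mu> by (simp flip: indicator_inter_arith)
    also have "\<dots> = (\<integral>\<^sup>+p. indicator S (\<Psi> p) * indicator X (\<Psi> p) \<partial>?P)"
      unfolding \<mu>_def by (subst nn_integral_distr) auto
    also have "\<dots> = (\<integral>\<^sup>+\<tau>. (\<integral>\<^sup>+y. indicator S (\<Psi> (\<tau>, y)) * indicator X (\<Psi> (\<tau>, y)) \<partial>\<mu>') \<partial>lborel)"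
      by (rule M.nn_integral_fst[symmetric]) measurable
    also have "\<dots> = (\<integral>\<^sup>+\<tau>. H \<tau> * K X \<tau> \<partial>lborel)"
    proof (rule nn_integral_cong_AE)
      show "AE \<tau> in lborel. (\<integral>\<^sup>+y. indicator S (\<Psi> (\<tau>, y)) * indicator X (\<Psi> (\<tau>, y)) \<partial>\<mu>') = H \<tau> * K X \<tau>"
        using AE_lborel_singleton[of 0] AE_lborel_singleton[of 1] by eventually_elim (rule slice[OF X])
    qed
    also have "\<dots> / emeasure \<mu> S = (\<integral>\<^sup>+\<tau>. H \<tau> * K X \<tau> / emeasure \<mu> S \<partial>lborel)"
      by (rule nn_integral_divide[symmetric]) measurable
    also have "\<dots> = (\<integral>\<^sup>+\<tau>. H \<tau> / emeasure \<mu> S * K X \<tau> \<partial>lborel)"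
      by (simp add: ennreal_divide_times ennreal_times_divide)
    also have "\<dots> = (\<integral>\<^sup>+\<tau>. K X \<tau> \<partial>\<rho>)"
      unfolding \<rho>_def by (rule nn_integral_density[symmetric]) measurable
    finally show ?thesis .
  qed
  show ?thesis
  proof
    show "sets \<rho> = sets borel" by fact
    show "prob_space \<rho>"
    proof
      interpret US: prob_space "uniform_on S" by (rule prob_space_uniform_on[OF S])
      have "space (uniform_on S) = UNIV" using sets_eq_imp_space_eq[OF sets_uniform_on[OF S]] by simp
      then have "1 = emeasure (uniform_on S) UNIV" using US.emeasure_space_1 by simp
      also have "\<dots> = (\<integral>\<^sup>+\<tau>. K UNIV \<tau> \<partial>\<rho>)" by (rule em) simp
      also have "\<dots> = emeasure \<rho> (space \<rho>)" by (simp add: K_def U.emeasure_space_1)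
      finally show "emeasure \<rho> (space \<rho>) = 1" by simp
    qed
    show "AE \<tau> in \<rho>. 0 < \<tau> \<and> \<tau> < 1"
      unfolding \<rho>_def by (subst AE_density) (auto simp: H_def split: split_indicator)
    have m[measurable]: "(\<lambda>(\<tau>, y). \<tau> *\<^sub>R v + (1 - \<tau>) *\<^sub>R y) \<in> \<rho> \<Otimes>\<^sub>M U \<rightarrow>\<^sub>M borel" by measurable
    show "uniform_on (convex hull insert v F) =
        distr (\<rho> \<Otimes>\<^sub>M uniform_on F) borel (\<lambda>(\<tau>, y). \<tau> *\<^sub>R v + (1 - \<tau>) *\<^sub>R y)"
      unfolding S_def[symmetric] U_def[symmetric]
    proof (rule measure_eqI)
      show "sets (uniform_on S) = sets (distr (\<rho> \<Otimes>\<^sub>M U) borel (\<lambda>(\<tau>, y). \<tau> *\<^sub>R v + (1 - \<tau>) *\<^sub>R y))"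
        by (simp add: sets_uniform_on[OF S])
      fix X assume "X \<in> sets (uniform_on S)"
      then have X[measurable]: "X \<in> sets borel" by (simp add: sets_uniform_on[OF S])
      have "emeasure (distr (\<rho> \<Otimes>\<^sub>M U) borel (\<lambda>(\<tau>, y). \<tau> *\<^sub>R v + (1 - \<tau>) *\<^sub>R y)) X =
         (\<integral>\<^sup>+x. indicator X x \<partial>distr (\<rho> \<Otimes>\<^sub>M U) borel (\<lambda>(\<tau>, y). \<tau> *\<^sub>R v + (1 - \<tau>) *\<^sub>R y))"
        by simp
      also have "\<dots> = (\<integral>\<^sup>+p. indicator X ((\<lambda>(\<tau>, y). \<tau> *\<^sub>R v + (1 - \<tau>) *\<^sub>R y) p) \<partial>(\<rho> \<Otimes>\<^sub>M U))"
        by (subst nn_integral_distr) auto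
      also have "\<dots> = (\<integral>\<^sup>+\<tau>. \<integral>\<^sup>+y. indicator X ((\<lambda>(\<tau>, y). \<tau> *\<^sub>R v + (1 - \<tau>) *\<^sub>R y) (\<tau>, y)) \<partial>U \<partial>\<rho>)"
        by (rule U.nn_integral_fst[symmetric]) measurable
      also have "\<dots> = (\<integral>\<^sup>+\<tau>. K X \<tau> \<partial>\<rho>)" by (simp add: K_def)
      also have "\<dots> = emeasure (uniform_on S) X" by (rule em[OF X, symmetric])
      finally show "emeasure (uniform_on S) X =
          emeasure (distr (\<rho> \<Otimes>\<^sub>M U) borel (\<lambda>(\<tau>, y). \<tau> *\<^sub>R v + (1 - \<tau>) *\<^sub>R y)) X" ..
    qed
  qed
qed

section \<open>Simplices: barycentric coordinates and the relative boundary\<close>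

text \<open>
  The points where two affine maps agree form an affine set.
\<close>

lemma affine_maps_eq_on_affine_hull:
  assumes "linear M" "linear N" and eq: "\<And>w. w \<in> W \<Longrightarrow> c + M w = d + N w" and x: "x \<in> affine hull W"
  shows "c + M x = d + N x"
proof -
  have "affine {x. c + M x = d + N x}"
    unfolding affine_def
  proof (intro ballI allI impI)
    fix x y and u v :: real
    assume *: "x \<in> {x. c + M x = d + N x}" "y \<in> {x. c + M x = d + N x}" "u + v = 1"
    have "c + M (u *\<^sub>R x + v *\<^sub>R y) = (u + v) *\<^sub>R c + u *\<^sub>R M x + v *\<^sub>R M y"
      using *(3) assms(1) by (simp add: linear_add linear_scale)
    also have "\<dots> = u *\<^sub>R (c + M x) + v *\<^sub>R (c + M y)" by (simp add: algebra_simps)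
    also have "\<dots> = u *\<^sub>R (d + N x) + v *\<^sub>R (d + N y)" using *(1,2) by simp
    also have "\<dots> = (u + v) *\<^sub>R d + u *\<^sub>R N x + v *\<^sub>R N y" by (simp add: algebra_simps)
    also have "\<dots> = d + N (u *\<^sub>R x + v *\<^sub>R y)"
      using *(3) assms(2) by (simp add: linear_add linear_scale)
    finally show "u *\<^sub>R x + v *\<^sub>R y \<in> {x. c + M x = d + N x}" by simp
  qed
  then have "affine hull W \<subseteq> {x. c + M x = d + N x}"
    using eq by (intro hull_minimal) auto
  then show ?thesis using x by auto
qed

lemma affine_independent_extend:
  fixes y :: "'a::euclidean_space \<Rightarrow> 'b::euclidean_space"
  assumes "\<not> affine_dependent W"
  obtains M c where "linear M" "\<And>w. w \<in> W \<Longrightarrow> c + M w = y w"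
proof (cases "W = {}")
  case True
  then show ?thesis using that[of "\<lambda>_. 0" 0] by (simp add: linear_zero)
next
  case False
  then obtain a where a: "a \<in> W" by blast
  have "independent ((\<lambda>x. - a + x) ` (W - {a}))"
    using assms affine_dependent_iff_dependent2[OF a] by simp
  then obtain g where g: "linear g" "\<forall>x\<in>(\<lambda>x. - a + x) ` (W - {a}). g x = y (x + a) - y a"
    using linear_independent_extend[of _ "\<lambda>z. y (z + a) - y a"] by blast
  show ?thesis
  proof (rule that[of g "y a - g a"])
    fix w assume w: "w \<in> W"
    show "y a - g a + g w = y w"
    proof (cases "w = a")
      case False
      then have "g (- a + w) = y w - y a" using g(2) w by simp
      moreover have "g (- a + w) = g w - g a" using g(1) by (simp add: linear_diff)
      ultimately have "g w - g a = y w - y a" by simp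
      then have "y a + (g w - g a) = y w" by simp
      then show ?thesis by (simp add: add_diff_eq diff_add_eq)
    qed simp
  qed fact
qed

lemma integrable_uniform_on_continuous:
  fixes f :: "'a::euclidean_space \<Rightarrow> real"
  assumes S: "convex_body S" and f: "continuous_on UNIV f"
  shows "integrable (uniform_on S) f"
proof -
  interpret prob_space "uniform_on S" by (rule prob_space_uniform_on[OF S])
  have "compact (f ` S)"
    using S f by (intro compact_continuous_image) (auto simp: convex_body_def intro: continuous_on_subset)
  then obtain B where B: "\<And>x. x \<in> S \<Longrightarrow> norm (f x) \<le> B"
    using compact_imp_bounded[THEN bounded_iff[THEN iffD1]] by (metis imageI)
  show ?thesis
  proof (rule integrable_const_bound)
    show "AE x in uniform_on S. norm (f x) \<le> B"
      using AE_uniform_on[OF S] by eventually_elim (rule B)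
    show "f \<in> borel_measurable (uniform_on S)"
      using borel_measurable_continuous_onI[OF f] measurable_cong_sets[OF sets_uniform_on[OF S] refl] by blast
  qed
qed

lemma continuous_on_affine_map:
  fixes M :: "'a::euclidean_space \<Rightarrow> 'b::real_normed_vector"
  shows "linear M \<Longrightarrow> continuous_on X (\<lambda>x. c + M x)"
  by (intro continuous_intros linear_continuous_on) (simp add: linear_conv_bounded_linear)

text \<open>
  The barycentric coordinates of a uniform point of a simplex add up to \<open>1\<close>, so it suffices that
  they all have the same expectation. Two of them are exchanged by the affine map that swaps the
  corresponding vertices; this map takes the simplex to itself and thus preserves the uniform
  distribution.
\<close>

lemma expectation_barycentric_coordinate:
  fixes W :: "'a::euclidean_space set"
  assumes W: "\<not> affine_dependent W" and v: "v \<in> W"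
    and M: "linear M" "c + M v = 1" "\<And>w. w \<in> W \<Longrightarrow> w \<noteq> v \<Longrightarrow> c + M w = (0::real)"
  shows "(\<integral>x. c + M x \<partial>uniform_on (convex hull W)) = 1 / card W"
proof -
  have fin: "finite W" by (rule aff_independent_finite[OF W])
  define S where "S = convex hull W"
  have S: "convex_body S" unfolding S_def using fin v by (intro convex_body_convex_hull) auto
  define U where "U = uniform_on S"
  interpret U: prob_space U unfolding U_def by (rule prob_space_uniform_on[OF S])
  have SA: "S \<subseteq> affine hull W" unfolding S_def by (rule convex_hull_subset_affine_hull)
  have "\<forall>p\<in>W. \<exists>N d. linear N \<and> (\<forall>w\<in>W. d + N w = (if w = p then 1 else 0 :: real))"
  proof
    fix p assume "p \<in> W"
    obtain N d where "linear N" "\<And>w. w \<in> W \<Longrightarrow> d + N w = (if w = p then 1 else 0 :: real)"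
      using affine_independent_extend[OF W, of "\<lambda>w. if w = p then 1 else 0 :: real"] by blast
    then show "\<exists>N d. linear N \<and> (\<forall>w\<in>W. d + N w = (if w = p then 1 else 0 :: real))" by blast
  qed
  then obtain N d where N: "\<And>p. p \<in> W \<Longrightarrow> linear (N p)"
    "\<And>p w. p \<in> W \<Longrightarrow> w \<in> W \<Longrightarrow> d p + N p w = (if w = p then 1 else 0 :: real)"
    by metis
  define I where "I p = (\<integral>x. d p + N p x \<partial>U)" for p
  have int: "integrable U (\<lambda>x. d p + N p x)" if "p \<in> W" for p
    unfolding U_def using integrable_uniform_on_continuous[OF S continuous_on_affine_map[OF N(1)[OF that]]] .
  have I_eq: "I p = I q" if p: "p \<in> W" and q: "q \<in> W" for p q
  proof -
    \<comment> \<open>\<open>\<phi>\<close> is the affine extension of the transposition of the vertices \<open>p\<close> and \<open>q\<close>\<close>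
    define \<sigma> where "\<sigma> w = (if w = p then q else if w = q then p else w)" for w
    have \<sigma>W: "\<sigma> ` W = W"
      using p q unfolding \<sigma>_def by (auto simp: image_iff)
    obtain L e where L: "linear L" "\<And>w. w \<in> W \<Longrightarrow> e + L w = \<sigma> w"
      using affine_independent_extend[OF W, of \<sigma>] by blast
    define \<phi> where "\<phi> z = e + L z" for z
    have \<phi>W: "\<phi> ` W = W" using \<sigma>W L(2) by (simp add: \<phi>_def)
    have \<phi>S: "\<phi> ` S = S"
      unfolding S_def using convex_hull_affine_image[OF L(1) \<phi>_def, of W] \<phi>W by simp
    \<comment> \<open>\<open>\<phi>\<close> is an involution on the vertices, hence on their affine hull\<close>
    have \<phi>\<phi>: "\<phi> (\<phi> z) = z" if "z \<in> affine hull W" for z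
    proof -
      have "linear (\<lambda>z. L (L z))" using linear_compose[OF L(1) L(1)] by (simp add: o_def)
      moreover have "(e + L e) + L (L w) = 0 + w" if w: "w \<in> W" for w
      proof -
        have "(e + L e) + L (L w) = e + L (e + L w)" using L(1) by (simp add: linear_add)
        also have "\<dots> = e + L (\<sigma> w)" using L(2)[OF w] by simp
        also have "\<dots> = \<sigma> (\<sigma> w)" using L(2)[of "\<sigma> w"] \<sigma>W w by auto
        also have "\<dots> = w" by (auto simp: \<sigma>_def)
        finally show ?thesis by simp
      qed
      ultimately have "(e + L e) + L (L z) = 0 + z"
        by (rule affine_maps_eq_on_affine_hull[OF _ linear_id[unfolded id_def] _ that])
      then show ?thesis using L(1) by (simp add: \<phi>_def linear_add add.assoc)
    qed
    have "inj_on \<phi> (affine hull W)" using \<phi>\<phi> by (metis inj_onI)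
    then have "uniform_on (\<phi> ` S) = distr U borel \<phi>"
      unfolding U_def using uniform_on_affine_image[OF S L(1) \<phi>_def] by (simp add: S_def)
    then have UU: "U = distr U borel \<phi>" by (simp add: \<phi>S U_def)
    have "I p = (\<integral>x. d p + N p x \<partial>distr U borel \<phi>)" unfolding I_def using UU by simp
    also have "\<dots> = (\<integral>x. d p + N p (\<phi> x) \<partial>U)"
    proof (rule integral_distr)
      show "\<phi> \<in> U \<rightarrow>\<^sub>M borel"
        using borel_measurable_continuous_onI[OF continuous_on_affine_map[OF L(1), of UNIV e]]
          measurable_cong_sets[OF sets_uniform_on[OF S] refl] by (auto simp: \<phi>_def[abs_def] U_def)
      show "(\<lambda>x. d p + N p x) \<in> borel_measurable borel"
        by (rule borel_measurable_continuous_onI[OF continuous_on_affine_map[OF N(1)[OF p]]])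
    qed
    also have "\<dots> = (\<integral>x. d q + N q x \<partial>U)"
    proof (rule integral_cong_AE)
      show "(\<lambda>x. d q + N q x) \<in> borel_measurable U" using int[OF q] by blast
      have eq: "(\<lambda>x. d p + N p (\<phi> x)) = (\<lambda>x. (d p + N p e) + N p (L x))"
        using N(1)[OF p] by (simp add: \<phi>_def linear_add add.assoc)
      have lin: "linear (\<lambda>x. N p (L x))" using linear_compose[OF L(1) N(1)[OF p]] by (simp add: o_def)
      show "(\<lambda>x. d p + N p (\<phi> x)) \<in> borel_measurable U"
        unfolding eq U_def
        using integrable_uniform_on_continuous[OF S continuous_on_affine_map[OF lin]] by blast
      have "d p + N p (\<phi> x) = d q + N q x" if "x \<in> affine hull W" for x
      proof -
        have "(d p + N p e) + N p (L w) = d q + N q w" if w: "w \<in> W" for w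
        proof -
          have "(d p + N p e) + N p (L w) = d p + N p (e + L w)" using N(1)[OF p] by (simp add: linear_add)
          also have "\<dots> = d p + N p (\<sigma> w)" using L(2)[OF w] by simp
          also have "\<dots> = (if \<sigma> w = p then 1 else 0)" using N(2)[OF p, of "\<sigma> w"] \<sigma>W w by blast
          also have "\<dots> = d q + N q w" using N(2)[OF q w] by (auto simp: \<sigma>_def)
          finally show ?thesis .
        qed
        then have "(d p + N p e) + N p (L x) = d q + N q x"
          by (rule affine_maps_eq_on_affine_hull[OF lin N(1)[OF q] _ that])
        then show ?thesis using fun_cong[OF eq, of x] by simp
      qed
      then show "AE x in U. d p + N p (\<phi> x) = d q + N q x"
        using AE_uniform_on[OF S] SA unfolding U_def by (auto elim: eventually_mono)
    qed
    finally show ?thesis by (simp add: I_def)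
  qed
  have "real (card W) * I v = (\<Sum>p\<in>W. I p)" using I_eq[OF _ v] by simp
  also have "\<dots> = (\<integral>x. (\<Sum>p\<in>W. d p + N p x) \<partial>U)"
    unfolding I_def using int by (simp add: Bochner_Integration.integral_sum)
  also have "\<dots> = (\<integral>x. 1 \<partial>U)"
  proof (rule integral_cong_AE)
    show "(\<lambda>x. \<Sum>p\<in>W. d p + N p x) \<in> borel_measurable U"
      using int by (intro borel_measurable_sum) blast
    have "(\<Sum>p\<in>W. d p + N p x) = 1" if "x \<in> affine hull W" for x
    proof -
      have "sum d W + (\<Sum>p\<in>W. N p x) = 1 + 0"
      proof (rule affine_maps_eq_on_affine_hull[OF _ linear_zero _ that])
        show "linear (\<lambda>x. \<Sum>p\<in>W. N p x)" using N(1) by (intro linear_compose_sum) auto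
        fix w assume "w \<in> W"
        then show "sum d W + (\<Sum>p\<in>W. N p w) = 1 + 0"
          using N(2)[of _ w] fin by (simp flip: sum.distrib)
      qed
      then show ?thesis by (simp add: sum.distrib)
    qed
    then show "AE x in U. (\<Sum>p\<in>W. d p + N p x) = 1"
      using AE_uniform_on[OF S] SA unfolding U_def by (auto elim: eventually_mono)
  qed simp
  also have "\<dots> = 1" using U.prob_space by simp
  finally have "real (card W) * I v = 1" .
  moreover have "card W \<noteq> 0" using fin v by auto
  ultimately have Iv: "I v = 1 / card W" by (simp add: eq_divide_eq mult.commute)
  have "(\<integral>x. c + M x \<partial>U) = I v"
    unfolding I_def
  proof (rule integral_cong_AE)
    show "(\<lambda>x. c + M x) \<in> borel_measurable U"
      unfolding U_def using integrable_uniform_on_continuous[OF S continuous_on_affine_map[OF M(1)]] by blast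
    show "(\<lambda>x. d v + N v x) \<in> borel_measurable U" using int[OF v] by blast
    have "c + M x = d v + N v x" if "x \<in> affine hull W" for x
      by (rule affine_maps_eq_on_affine_hull[OF M(1) N(1)[OF v] _ that]) (use M N(2)[OF v] in auto)
    then show "AE x in U. c + M x = d v + N v x"
      using AE_uniform_on[OF S] SA unfolding U_def by (auto elim: eventually_mono)
  qed
  then show ?thesis using Iv by (simp add: U_def S_def)
qed

lemma notin_affine_hull_Diff:
  "\<not> affine_dependent W \<Longrightarrow> w \<in> W \<Longrightarrow> w \<notin> affine hull (W - {w})"
  by (auto simp: affine_dependent_def)

text \<open>
  A point of the simplex outside the relative interior has a vanishing barycentric coordinate and
  so lies in the affine hull of a facet. Regard the simplex as a cone over this facet: the height
  of a random point is almost surely positive.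
\<close>

lemma AE_uniform_on_rel_interior:
  fixes W :: "'a::euclidean_space set"
  assumes W: "\<not> affine_dependent W" "W \<noteq> {}"
  shows "AE x in uniform_on (convex hull W). x \<in> rel_interior (convex hull W)"
proof -
  have fin: "finite W" by (rule aff_independent_finite[OF W(1)])
  define S where "S = convex hull W"
  have S: "convex_body S" unfolding S_def using fin W by (intro convex_body_convex_hull) auto
  have facet: "AE x in uniform_on S. x \<notin> affine hull (W - {w})" if w: "w \<in> W" for w
  proof (cases "W = {w}")
    case True
    then show ?thesis by simp
  next
    case False
    define F where "F = convex hull (W - {w})"
    have F: "convex_body F" unfolding F_def using fin False w by (intro convex_body_convex_hull) auto
    have aF: "affine hull F = affine hull (W - {w})" by (simp add: F_def)
    have wF: "w \<notin> affine hull F" unfolding aF by (rule notin_affine_hull_Diff[OF W(1) w])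
    have SF: "convex hull (insert w F) = S"
      unfolding F_def S_def using w by (simp add: insert_absorb flip: hull_insert)
    obtain \<rho> where \<rho>: "prob_space \<rho>" "sets \<rho> = sets borel" "AE \<tau> in \<rho>. 0 < \<tau> \<and> \<tau> < 1"
      "uniform_on S = distr (\<rho> \<Otimes>\<^sub>M uniform_on F) borel (\<lambda>(\<tau>, y). \<tau> *\<^sub>R w + (1 - \<tau>) *\<^sub>R y)"
      using uniform_on_cone[OF F wF] unfolding SF by blast
    interpret R: prob_space \<rho> by fact
    interpret U: prob_space "uniform_on F" by (rule prob_space_uniform_on[OF F])
    interpret P: pair_sigma_finite \<rho> "uniform_on F" ..
    note [measurable_cong] = \<rho>(2) sets_uniform_on[OF F]
    have [measurable]: "affine hull (W - {w}) \<in> sets borel" by (rule borel_closed[OF closed_affine_hull])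
    show ?thesis unfolding \<rho>(4)
    proof (subst AE_distr_iff)
      show "AE x in \<rho> \<Otimes>\<^sub>M uniform_on F.
          (case x of (\<tau>, y) \<Rightarrow> \<tau> *\<^sub>R w + (1 - \<tau>) *\<^sub>R y) \<notin> affine hull (W - {w})"
      proof (rule P.AE_pair_measure)
        show "AE x in \<rho>. AE y in uniform_on F. (case (x, y) of (\<tau>, y) \<Rightarrow> \<tau> *\<^sub>R w + (1 - \<tau>) *\<^sub>R y) \<notin> affine hull (W - {w})"
          using \<rho>(3)
        proof eventually_elim
          case (elim \<tau>)
          show ?case using AE_uniform_on[OF F]
          proof eventually_elim
            case (elim y)
            then have y: "y \<in> affine hull F" by (rule hull_inc)
            show ?case
            proof
              assume "(case (\<tau>, y) of (\<tau>, y) \<Rightarrow> \<tau> *\<^sub>R w + (1 - \<tau>) *\<^sub>R y) \<in> affine hull (W - {w})"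
              then have z: "\<tau> *\<^sub>R w + (1 - \<tau>) *\<^sub>R y \<in> affine hull F" by (simp add: aF)
              have "1 / \<tau> + (- (1 - \<tau>) / \<tau>) = 1" using \<open>0 < \<tau> \<and> \<tau> < 1\<close> by (simp add: field_simps)
              then have "(1 / \<tau>) *\<^sub>R (\<tau> *\<^sub>R w + (1 - \<tau>) *\<^sub>R y) + (- (1 - \<tau>) / \<tau>) *\<^sub>R y \<in> affine hull F"
                by (rule mem_affine[OF affine_affine_hull z y])
              also have "(1 / \<tau>) *\<^sub>R (\<tau> *\<^sub>R w + (1 - \<tau>) *\<^sub>R y) + (- (1 - \<tau>) / \<tau>) *\<^sub>R y = w"
                using \<open>0 < \<tau> \<and> \<tau> < 1\<close> by (simp add: scaleR_right_distrib diff_divide_distrib flip: scaleR_left_distrib)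
              finally show False using wF by blast
            qed
          qed
        qed
      qed measurable
    qed measurable
  qed
  have "AE x in uniform_on S. \<forall>w\<in>W. x \<notin> affine hull (W - {w})"
    using facet fin by (subst AE_ball_countable) (auto intro: countable_finite)
  then show ?thesis
    unfolding S_def[symmetric] using AE_uniform_on[OF S]
  proof eventually_elim
    case (elim x)
    obtain u where u: "\<forall>w\<in>W. 0 \<le> u w" "sum u W = 1" "(\<Sum>w\<in>W. u w *\<^sub>R w) = x"
      using elim(2) unfolding S_def convex_hull_finite[OF fin] by blast
    have "0 < u w" if w: "w \<in> W" for w
    proof (rule ccontr)
      assume "\<not> 0 < u w"
      then have "u w = 0" using u(1) w by force
      then have "sum u (W - {w}) = 1" "(\<Sum>w'\<in>W - {w}. u w' *\<^sub>R w') = x"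
        using u fin w by (simp_all add: sum.remove[of W w])
      then have "x \<in> affine hull (W - {w})" using fin by (auto simp: affine_hull_finite)
      then show False using elim(1) w by blast
    qed
    then show ?case unfolding S_def rel_interior_convex_hull_explicit[OF W(1)] using u by blast
  qed
qed

section \<open>Integrability of convex functions on a simplex\<close>

text \<open>
  Composing \<open>f\<close> with an affine retraction \<open>P\<close> of the whole space onto the affine hull turns it into a
  convex function on an open set.
\<close>

lemma convex_on_continuous_relatively_open:
  fixes f :: "'a::euclidean_space \<Rightarrow> real"
  assumes f: "convex_on S f" and op: "openin (top_of_set (affine hull S)) S"
  shows "continuous_on S f"
proof (cases "S = {}")
  case False
  then obtain a where a: "a \<in> S" by blast
  let ?A = "affine hull S"
  have aA: "a \<in> ?A" using a by (rule hull_inc)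
  define V where "V = (\<lambda>x. x - a) ` ?A"
  have V: "subspace V" unfolding V_def by (rule affine_diffs_subspace_subtract[OF affine_affine_hull aA])
  obtain g where g: "g ` UNIV \<subseteq> V" "linear g" "\<forall>v\<in>V. g v = v"
    using linear_exists_left_inverse_on[of "\<lambda>x. x" V] V linear_id[unfolded id_def] by auto
  define P where "P z = (a - g a) + g z" for z
  have P: "P z = a + g (z - a)" for z using g(2) by (simp add: P_def linear_diff)
  have PA: "P z \<in> ?A" for z
  proof -
    have "g (z - a) \<in> V" using g(1) by blast
    then show ?thesis unfolding P V_def by auto
  qed
  have Pid: "P z = z" if "z \<in> ?A" for z
  proof -
    have "z - a \<in> V" using that by (simp add: V_def)
    then show ?thesis using g(3) by (simp add: P)
  qed
  have Pc: "continuous_on UNIV P"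
    unfolding P_def by (rule continuous_on_affine_map[OF g(2)])
  have Pcomb: "P (u *\<^sub>R y + v *\<^sub>R z) = u *\<^sub>R P y + v *\<^sub>R P z" if "u + v = 1" for u v y z
  proof -
    have "P (u *\<^sub>R y + v *\<^sub>R z) = (u + v) *\<^sub>R (a - g a) + (u *\<^sub>R g y + v *\<^sub>R g z)"
      using g(2) that by (simp add: P_def linear_add linear_scale)
    also have "\<dots> = u *\<^sub>R P y + v *\<^sub>R P z"
      unfolding P_def by (simp only: scaleR_add_left scaleR_add_right add_ac)
    finally show ?thesis .
  qed
  obtain T where T: "open T" "S = ?A \<inter> T" using op unfolding openin_open by blast
  have O: "P -` S = P -` T" using PA T(2) by auto
  have "open (P -` S)" unfolding O using Pc T(1) by (simp add: continuous_on_open_vimage)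
  moreover have "convex_on (P -` S) (\<lambda>z. f (P z))"
  proof (rule convex_onI)
    have cS: "convex S" using f by (rule convex_on_imp_convex)
    show "convex (P -` S)"
      by (intro convexI) (auto simp: Pcomb intro: convexD[OF cS])
    fix t :: real and y z assume t: "0 < t" "t < 1" and "y \<in> P -` S" "z \<in> P -` S"
    then show "f (P ((1 - t) *\<^sub>R y + t *\<^sub>R z)) \<le> (1 - t) * f (P y) + t * f (P z)"
      using convex_onD[OF f, of t "P y" "P z"] by (simp add: Pcomb)
  qed
  ultimately have "continuous_on (P -` S) (\<lambda>z. f (P z))" by (rule convex_on_continuous)
  moreover have "S \<subseteq> P -` S" using Pid hull_subset[of S affine] by force
  ultimately have "continuous_on S (\<lambda>z. f (P z))" by (rule continuous_on_subset)
  moreover have "f (P z) = f z" if "z \<in> S" for z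
    using Pid[OF hull_inc[OF that]] by simp
  ultimately show ?thesis by (simp cong: continuous_on_cong)
qed simp

lemma rel_interior_borel: "rel_interior S \<in> sets borel"
  for S :: "'a::euclidean_space set"
proof -
  obtain T where "open T" "rel_interior S = affine hull S \<inter> T"
    using openin_rel_interior[of S] unfolding openin_open by blast
  then show ?thesis by (simp add: borel_open sets.Int)
qed

text \<open>
  A convex function is continuous on the relative interior of its domain, but on a round piece of the
  relative boundary it need not even be Borel measurable; hence the cut-off.
\<close>

lemma convex_on_rel_interior_borel_measurable:
  fixes f :: "'a::euclidean_space \<Rightarrow> real"
  assumes f: "convex_on S f"
  shows "(\<lambda>x. indicator (rel_interior S) x * f x) \<in> borel_measurable borel"
proof -
  have S: "convex S" using f by (rule convex_on_imp_convex)
  have "openin (top_of_set (affine hull (rel_interior S))) (rel_interior S)"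
    using openin_rel_interior[of S] rel_interior_same_affine_hull[OF S] by simp
  then have "continuous_on (rel_interior S) f"
    by (rule convex_on_continuous_relatively_open[rotated])
      (rule convex_on_subset[OF f rel_interior_subset convex_rel_interior[OF S]])
  then have "(\<lambda>x. indicator (rel_interior S) x *\<^sub>R f x) \<in> borel_measurable borel"
    by (rule borel_measurable_continuous_on_indicator[OF rel_interior_borel])
  then show ?thesis by simp
qed

text \<open>
  An upper bound is the maximum over the vertices. For the lower bound take \<open>b\<close> in the relative
  interior: there is a fixed \<open>k > 0\<close> such that, for every \<open>x\<close> in the polytope, the point
  \<open>b + k *\<^sub>R (b - x)\<close> beyond \<open>b\<close> is also in it. Since \<open>b\<close> lies between this point and \<open>x\<close>, a very
  small value of \<open>f x\<close> would contradict the upper bound at the other end.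
\<close>

lemma convex_on_polytope_bounded:
  fixes f :: "'a::euclidean_space \<Rightarrow> real"
  assumes W: "finite W" "W \<noteq> {}" and f: "convex_on (convex hull W) f"
  obtains B where "\<And>x. x \<in> convex hull W \<Longrightarrow> \<bar>f x\<bar> \<le> B"
proof -
  let ?S = "convex hull W"
  define u where "u = Max (f ` W)"
  have up: "f x \<le> u" if "x \<in> ?S" for x
    using convex_on_convex_hull_bound[OF f, of u] W that by (simp add: u_def)
  have "rel_interior ?S \<noteq> {}" using W by (simp add: rel_interior_eq_empty)
  then obtain b where "b \<in> rel_interior ?S" by blast
  then obtain e where b: "b \<in> ?S" and e: "e > 0" "cball b e \<inter> affine hull ?S \<subseteq> ?S"
    unfolding mem_rel_interior_cball by blast
  have "bounded ?S" using W by (simp add: compact_imp_bounded finite_imp_compact_convex_hull)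
  then obtain D where D: "0 < D" "\<And>x. x \<in> ?S \<Longrightarrow> norm (x - b) \<le> D"
  proof -
    from \<open>bounded ?S\<close> obtain R where "?S \<subseteq> ball b R" "0 < R" using bounded_subset_ballD by blast
    then show ?thesis using that[of R] by (auto simp: dist_norm norm_minus_commute subset_iff less_imp_le)
  qed
  define k where "k = e / D"
  have k: "k > 0" using e D by (simp add: k_def)
  have k1: "(1 + k) * (1 - k / (1 + k)) = 1" "(1 + k) * (k / (1 + k)) = k"
    using k by (simp_all add: field_simps)
  have low: "((1 + k) * f b - u) / k \<le> f x" if x: "x \<in> ?S" for x
  proof -
    define y where "y = b + k *\<^sub>R (b - x)"
    have "norm (b - y) \<le> e"
    proof -
      have "norm (b - y) = k * norm (x - b)" using k by (simp add: y_def norm_minus_commute)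
      also have "\<dots> \<le> k * D" using k D(2)[OF x] by simp
      finally show ?thesis using D by (simp add: k_def)
    qed
    moreover have "y \<in> affine hull ?S"
    proof -
      have "b \<in> affine hull ?S" "x \<in> affine hull ?S" using b x by (simp_all only: hull_inc)
      from mem_affine_3_minus[OF affine_affine_hull this(1) this(1) this(2)] show ?thesis
        by (simp only: y_def)
    qed
    ultimately have y: "y \<in> ?S" using e(2) by (auto simp: dist_norm)
    have "b = (1 - k / (1 + k)) *\<^sub>R y + (k / (1 + k)) *\<^sub>R x"
    proof -
      have "(1 + k) *\<^sub>R b = (1 + k) *\<^sub>R ((1 - k / (1 + k)) *\<^sub>R y + (k / (1 + k)) *\<^sub>R x)"
      proof -
        have "(1 + k) *\<^sub>R ((1 - k / (1 + k)) *\<^sub>R y + (k / (1 + k)) *\<^sub>R x) = y + k *\<^sub>R x"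
          by (simp only: scaleR_add_right scaleR_scaleR scaleR_one k1)
        then show ?thesis by (simp add: y_def algebra_simps)
      qed
      then show ?thesis using k by simp
    qed
    then have "f b \<le> (1 - k / (1 + k)) * f y + k / (1 + k) * f x"
      using convex_onD[OF f, of "k / (1 + k)" y x] k x y by simp
    also have "\<dots> \<le> (1 - k / (1 + k)) * u + k / (1 + k) * f x"
      using up[OF y] k by (intro add_right_mono mult_left_mono) auto
    finally have "(1 + k) * f b \<le> (1 + k) * ((1 - k / (1 + k)) * u + k / (1 + k) * f x)"
      using k by simp
    also have "\<dots> = u + k * f x"
      by (simp only: distrib_left mult.assoc[symmetric] k1 mult_1_left)
    finally show ?thesis using k by (simp add: field_simps)
  qed
  show ?thesis
  proof (rule that)
    fix x assume "x \<in> ?S"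
    from up[OF this] low[OF this]
    show "\<bar>f x\<bar> \<le> \<bar>u\<bar> + \<bar>((1 + k) * f b - u) / k\<bar>" by linarith
  qed
qed

text \<open>
  The mean value, with \<open>f\<close> replaced by \<open>0\<close> on the relative boundary, where a convex function can jump.
  For a simplex the boundary is a null set, so this does not affect the mean.
\<close>

definition average_on :: "'a::euclidean_space set \<Rightarrow> ('a \<Rightarrow> real) \<Rightarrow> real" where
  "average_on S f = (\<integral>x. indicator (rel_interior S) x * f x \<partial>uniform_on S)"

text \<open>
  The cut-off of \<open>f\<close> differs from \<open>f\<close> on a null set only. In the completed measure this also makes \<open>f\<close>
  itself measurable and gives both the same integral.
\<close>

lemma rel_integral_div_rel_volume:
  fixes f :: "'a::euclidean_space \<Rightarrow> real"
  assumes W: "\<not> affine_dependent W" "W \<noteq> {}" and f: "convex_on (convex hull W) f"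
  shows "1 / rel_volume (convex hull W) * rel_integral (convex hull W) f = average_on (convex hull W) f"
proof -
  define S where "S = convex hull W"
  have S: "convex_body S"
    unfolding S_def using aff_independent_finite[OF W(1)] W(2) by (rule convex_body_convex_hull)
  define \<mu> where "\<mu> = flat_lebesgue (affine hull S)"
  have \<mu>: "haar_on (affine hull S) \<mu>" unfolding \<mu>_def by (rule haar_on_flat_lebesgue_hull[OF S])
  note s = haar_onD(1,2)[OF \<mu>]
  have Sb: "S \<in> sets \<mu>" using convex_body_borel[OF S] s by simp
  note pos = haar_on_convex_body[OF S \<mu>]
  define m where "m = measure \<mu> S"
  have m1: "emeasure \<mu> S = ennreal m" unfolding m_def using pos(2) by (simp add: emeasure_eq_ennreal_measure)
  then have "ennreal m \<noteq> 0" using pos(1) by simp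
  then have "m > 0" by (simp add: ennreal_eq_0_iff not_le)
  note m = m1 this
  define g where "g x = indicator (rel_interior S) x * f x" for x
  have gb: "g \<in> borel_measurable borel"
    unfolding g_def[abs_def] S_def by (rule convex_on_rel_interior_borel_measurable[OF f])
  then have g\<mu>: "g \<in> borel_measurable \<mu>" using measurable_cong_sets[OF s(1) refl] by blast
  have AE: "AE x in \<mu>. x \<in> S \<longrightarrow> x \<in> rel_interior S"
    using AE_uniform_on_rel_interior[OF W] AE_uniform_measure[OF pos(1)] pos(2)
    unfolding S_def[symmetric] uniform_on_def \<mu>_def[symmetric] by (simp add: less_top)
  define N where "N = S - rel_interior S"
  have Ns: "N \<in> sets \<mu>" unfolding N_def using Sb rel_interior_borel[of S] s(1) by (metis sets.Diff)
  have "AE x in \<mu>. x \<notin> N"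
    using AE by eventually_elim (simp add: N_def)
  then have N: "N \<in> null_sets \<mu>" using AE_iff_null_sets[OF Ns] by simp
  define h where "h x = indicator S x *\<^sub>R f x" for x
  have hg: "h x = g x" if "x \<notin> N" for x
    using that rel_interior_subset[of S] by (auto simp: h_def g_def N_def indicator_def)
  have hm: "h \<in> borel_measurable (completion \<mu>)"
  proof (rule measurableI)
    fix X :: "real set" assume X: "X \<in> sets borel"
    have "h -` X \<inter> space (completion \<mu>) = (g -` X \<inter> space \<mu> - N) \<union> (h -` X \<inter> N)"
      using hg by (auto simp: s(2))
    moreover have "g -` X \<inter> space \<mu> - N \<in> sets (completion \<mu>)"
      using measurable_sets[OF g\<mu> X] Ns by (intro sets_completionI_sets sets.Diff)
    moreover have "h -` X \<inter> N \<in> null_sets (completion \<mu>)"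
      using null_sets_completionI[OF N] by (rule null_sets_completion_subset[rotated]) simp
    ultimately show "h -` X \<inter> space (completion \<mu>) \<in> sets (completion \<mu>)"
      by (simp add: null_setsD2 sets.Un)
  qed simp
  have "rel_integral S f = (\<integral>x. h x \<partial>completion \<mu>)"
    unfolding rel_integral_def affine_lebesgue_eq_completion \<mu>_def[symmetric] set_lebesgue_integral_def h_def ..
  also have "\<dots> = (\<integral>x. g x \<partial>completion \<mu>)"
  proof (rule integral_cong_AE)
    show "g \<in> borel_measurable (completion \<mu>)" using g\<mu> by (rule measurable_completion)
    have "AE x in \<mu>. h x = g x"
      using AE_not_in[OF N] by eventually_elim (rule hg)
    then show "AE x in completion \<mu>. h x = g x" by (rule AE_completion)
  qed (rule hm)
  also have "\<dots> = (\<integral>x. g x \<partial>\<mu>)" using g\<mu> by (rule integral_completion)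
  finally have I: "rel_integral S f = (\<integral>x. g x \<partial>\<mu>)" .
  have V: "rel_volume S = m"
    unfolding rel_volume_def affine_lebesgue_eq_completion \<mu>_def[symmetric] m_def
    using Sb by (rule measure_completion)
  have "uniform_on S = density \<mu> (\<lambda>x. ennreal (indicator S x / m))"
    unfolding uniform_on_def \<mu>_def[symmetric] uniform_measure_def m(1)
  proof (rule arg_cong[of _ _ "density \<mu>"], rule ext)
    fix x
    show "indicator S x / ennreal m = ennreal (indicator S x / m)"
      using m(2) by (auto simp: indicator_def divide_ennreal simp flip: ennreal_1)
  qed
  then have "average_on S f = (\<integral>x. g x \<partial>density \<mu> (\<lambda>x. ennreal (indicator S x / m)))"
    by (simp add: average_on_def g_def)
  also have "\<dots> = (\<integral>x. (indicator S x / m) *\<^sub>R g x \<partial>\<mu>)"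
    using g\<mu> Sb m(2) by (intro integral_density) auto
  also have "\<dots> = (\<integral>x. (1 / m) * g x \<partial>\<mu>)"
    using rel_interior_subset[of S] by (intro Bochner_Integration.integral_cong) (auto simp: g_def indicator_def)
  also have "\<dots> = 1 / m * (\<integral>x. g x \<partial>\<mu>)" by simp
  finally show ?thesis unfolding S_def[symmetric] I V by simp
qed

section \<open>Averages over a simplex and over its barycentric section\<close>

text \<open>
  In a simplex the relative interior consists of the points all of whose barycentric coordinates are
  positive.
\<close>

lemma cone_point_rel_interior:
  fixes W :: "'a::euclidean_space set"
  assumes W: "\<not> affine_dependent W" and v: "v \<in> W" and \<tau>: "0 < \<tau>" "\<tau> < 1"
    and y: "y \<in> rel_interior (convex hull (W - {v}))"
  shows "\<tau> *\<^sub>R v + (1 - \<tau>) *\<^sub>R y \<in> rel_interior (convex hull W)"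
proof -
  have fin: "finite W" by (rule aff_independent_finite[OF W])
  have W': "\<not> affine_dependent (W - {v})" using W affine_independent_Diff by blast
  obtain u where u: "\<forall>w\<in>W - {v}. 0 < u w" "sum u (W - {v}) = 1" "(\<Sum>w\<in>W - {v}. u w *\<^sub>R w) = y"
    using y unfolding rel_interior_convex_hull_explicit[OF W'] by blast
  define u' where "u' w = (if w = v then \<tau> else (1 - \<tau>) * u w)" for w
  have "sum u' W = \<tau> + (\<Sum>w\<in>W - {v}. (1 - \<tau>) * u w)"
    unfolding sum.remove[OF fin v] by (intro arg_cong2[of _ _ _ _ "(+)"] sum.cong) (auto simp: u'_def)
  then have 1: "sum u' W = 1" using u(2) by (simp flip: sum_distrib_left)
  have "(\<Sum>w\<in>W. u' w *\<^sub>R w) = \<tau> *\<^sub>R v + (\<Sum>w\<in>W - {v}. (1 - \<tau>) *\<^sub>R (u w *\<^sub>R w))"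
    unfolding sum.remove[OF fin v] by (intro arg_cong2[of _ _ _ _ "(+)"] sum.cong) (auto simp: u'_def)
  then have 2: "(\<Sum>w\<in>W. u' w *\<^sub>R w) = \<tau> *\<^sub>R v + (1 - \<tau>) *\<^sub>R y" by (simp only: u(3) flip: scaleR_sum_right)
  have "\<forall>w\<in>W. 0 < u' w" using u(1) \<tau> by (auto simp: u'_def)
  with 1 2 show ?thesis unfolding rel_interior_convex_hull_explicit[OF W] by blast
qed

lemma affine_independent_affine_image:
  fixes \<phi> :: "'a::euclidean_space \<Rightarrow> 'b::euclidean_space"
  assumes W: "\<not> affine_dependent W" and M: "linear M" and \<phi>: "\<And>z. \<phi> z = c + M z" and inj: "inj \<phi>"
  shows "\<not> affine_dependent (\<phi> ` W)"
proof
  assume "affine_dependent (\<phi> ` W)"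
  then obtain a where a: "a \<in> W" "\<phi> a \<in> affine hull (\<phi> ` W - {\<phi> a})"
    unfolding affine_dependent_def by auto
  have "\<phi> ` W - {\<phi> a} = \<phi> ` (W - {a})" using inj by (auto dest: injD)
  then have "\<phi> a \<in> \<phi> ` (affine hull (W - {a}))" using a(2) affine_hull_affine_image[OF M \<phi>] by simp
  then have "a \<in> affine hull (W - {a})" using inj by (auto dest: injD)
  then show False using notin_affine_hull_Diff[OF W a(1)] by blast
qed

text \<open>
  The heart of the matter. The map \<open>\<phi>\<close> takes the facet opposite to \<open>v\<close> to the section of the simplex
  that is parallel to this facet and passes through the barycenter. Let \<open>G \<tau>\<close> be the mean of
  \<open>f (\<tau> *\<^sub>R v + (1 - \<tau>) *\<^sub>R y)\<close> over \<open>y\<close> in the facet, that is, the average of \<open>f\<close> over the parallel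
  section at height \<open>\<tau>\<close>. Then \<open>G\<close> is convex on the open unit interval, its mean under the law \<open>\<rho>\<close> of the height is the average
  over the simplex, the mean height is \<open>1 / card W\<close>, and \<open>G\<close> takes the average over the barycentric
  section at that height. So the claim is Jensen's inequality for \<open>G\<close>.
\<close>

lemma average_on_section_le:
  fixes f :: "'a::euclidean_space \<Rightarrow> real"
  assumes W: "\<not> affine_dependent W" and v: "v \<in> W" and ne: "W \<noteq> {v}"
    and f: "convex_on (convex hull W) f"
  defines "\<phi> \<equiv> \<lambda>y. (1 / card W) *\<^sub>R v + (1 - 1 / card W) *\<^sub>R y"
  shows "average_on (convex hull (\<phi> ` (W - {v}))) f \<le> average_on (convex hull W) f"
proof -
  have fin: "finite W" by (rule aff_independent_finite[OF W])
  define m where "m = real (card W)"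
  have "card W > card {v}" using fin v ne by (intro psubset_card_mono) auto
  then have m: "m > 1" by (simp add: m_def)
  define W' where "W' = W - {v}"
  have W': "\<not> affine_dependent W'" "W' \<noteq> {}" "finite W'"
    using W v ne fin affine_independent_Diff by (auto simp: W'_def)
  define F where "F = convex hull W'"
  have F: "convex_body F" unfolding F_def using W'(3,2) by (rule convex_body_convex_hull)
  have aF: "affine hull F = affine hull W'" by (simp add: F_def)
  have vF: "v \<notin> affine hull F" unfolding aF W'_def by (rule notin_affine_hull_Diff[OF W v])
  define S where "S = convex hull W"
  have S: "convex_body S" unfolding S_def using fin v by (intro convex_body_convex_hull) auto
  have SF: "convex hull (insert v F) = S"
    unfolding F_def S_def W'_def using v by (simp add: insert_absorb flip: hull_insert)
  define pt where "pt \<tau> y = \<tau> *\<^sub>R v + (1 - \<tau>) *\<^sub>R y" for \<tau> y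
  obtain \<rho> where \<rho>: "prob_space \<rho>" "sets \<rho> = sets borel" "AE \<tau> in \<rho>. 0 < \<tau> \<and> \<tau> < 1"
    "uniform_on S = distr (\<rho> \<Otimes>\<^sub>M uniform_on F) borel (\<lambda>(\<tau>, y). pt \<tau> y)"
    using uniform_on_cone[OF F vF] unfolding SF pt_def by blast
  define U where "U = uniform_on F"
  interpret R: prob_space \<rho> by fact
  interpret U: prob_space U unfolding U_def by (rule prob_space_uniform_on[OF F])
  interpret P: pair_prob_space \<rho> U ..
  have [measurable_cong]: "sets \<rho> = sets borel" "sets U = sets borel"
    using \<rho>(2) sets_uniform_on[OF F] by (simp_all add: U_def)
  have ptm[measurable]: "(\<lambda>(\<tau>, y). pt \<tau> y) \<in> borel \<Otimes>\<^sub>M borel \<rightarrow>\<^sub>M borel" unfolding pt_def by measurable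
  have ptm1[measurable]: "pt \<tau> \<in> borel \<rightarrow>\<^sub>M borel" for \<tau> unfolding pt_def by measurable
  define g where "g x = indicator (rel_interior S) x * f x" for x
  have gm[measurable]: "g \<in> borel_measurable borel"
    unfolding g_def[abs_def] S_def by (rule convex_on_rel_interior_borel_measurable[OF f])
  obtain B where B: "\<And>x. x \<in> S \<Longrightarrow> \<bar>f x\<bar> \<le> B"
    using convex_on_polytope_bounded[OF fin _ f] v unfolding S_def by blast
  have "\<bar>f v\<bar> \<le> B" by (rule B) (use v in \<open>simp add: S_def hull_inc\<close>)
  then have gB: "norm (g x) \<le> B" for x
    using B[of x] rel_interior_subset[of S] by (auto simp: g_def indicator_def)
  have gf: "g x = f x" if "x \<in> rel_interior S" for x using that by (simp add: g_def)
  define G where "G \<tau> = (\<integral>y. g (pt \<tau> y) \<partial>U)" for \<tau>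
  have gint: "integrable U (\<lambda>y. g (pt \<tau> y))" for \<tau>
    by (rule U.integrable_const_bound[of _ B]) (simp_all add: gB[simplified])
  have Pint: "integrable (\<rho> \<Otimes>\<^sub>M U) (\<lambda>p. g (case p of (\<tau>, y) \<Rightarrow> pt \<tau> y))"
    by (rule P.integrable_const_bound[of _ B]) (simp_all add: gB[simplified])
  have avg: "average_on S f = (\<integral>\<tau>. G \<tau> \<partial>\<rho>)"
  proof -
    have "average_on S f = (\<integral>x. g x \<partial>distr (\<rho> \<Otimes>\<^sub>M U) borel (\<lambda>(\<tau>, y). pt \<tau> y))"
      unfolding average_on_def g_def \<rho>(4) U_def ..
    also have "\<dots> = (\<integral>p. g (case p of (\<tau>, y) \<Rightarrow> pt \<tau> y) \<partial>(\<rho> \<Otimes>\<^sub>M U))"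
      by (rule integral_distr) measurable
    also have "\<dots> = (\<integral>\<tau>. G \<tau> \<partial>\<rho>)"
      using P.integral_fst'[OF Pint] by (simp add: G_def)
    finally show ?thesis .
  qed
  have Gint: "integrable \<rho> G"
    using P.integrable_fst'[OF Pint] by (simp add: G_def[abs_def])
  have ri: "AE y in U. y \<in> rel_interior F"
    unfolding U_def F_def by (rule AE_uniform_on_rel_interior[OF W'(1,2)])
  have ptri: "pt \<tau> y \<in> rel_interior S" if "0 < \<tau>" "\<tau> < 1" "y \<in> rel_interior F" for \<tau> y
    unfolding pt_def S_def by (rule cone_point_rel_interior[OF W v that(1,2)]) (use that(3) in \<open>simp add: F_def W'_def\<close>)
  have Gconv: "convex_on {0<..<1} G"
  proof (rule convex_onI)
    fix t \<tau> \<tau>' :: real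
    assume t: "0 < t" "t < 1" and \<tau>: "\<tau> \<in> {0<..<1}" "\<tau>' \<in> {0<..<1}"
    let ?s = "(1 - t) * \<tau> + t * \<tau>'"
    have s: "?s \<in> {0<..<1}"
      using convexD[OF convex_real_interval(8)[of 0 1] \<tau>, of "1 - t" t] t by simp
    have "G ?s \<le> (\<integral>y. (1 - t) * g (pt \<tau> y) + t * g (pt \<tau>' y) \<partial>U)"
      unfolding G_def
    proof (rule integral_mono_AE)
      show "AE y in U. g (pt ?s y) \<le> (1 - t) * g (pt \<tau> y) + t * g (pt \<tau>' y)"
        using ri
      proof eventually_elim
        case (elim y)
        have "pt ?s y = (1 - t) *\<^sub>R pt \<tau> y + t *\<^sub>R pt \<tau>' y" by (simp add: pt_def algebra_simps)
        then have "f (pt ?s y) \<le> (1 - t) * f (pt \<tau> y) + t * f (pt \<tau>' y)"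
          using convex_onD[OF f, of t "pt \<tau> y" "pt \<tau>' y"] ptri[OF _ _ elim] \<tau> t rel_interior_subset[of S]
          by (auto simp: S_def)
        then show ?case using ptri[OF _ _ elim] \<tau> s by (simp add: gf)
      qed
    qed (use gint in auto)
    also have "\<dots> = (1 - t) * G \<tau> + t * G \<tau>'" unfolding G_def using gint by simp
    finally show "G ((1 - t) *\<^sub>R \<tau> + t *\<^sub>R \<tau>') \<le> (1 - t) * G \<tau> + t * G \<tau>'" by simp
  qed simp
  have idint: "integrable \<rho> (\<lambda>\<tau>. \<tau>)"
    by (rule R.integrable_const_bound[of _ 1]) (use \<rho>(3) in \<open>auto elim: eventually_mono\<close>)
  \<comment> \<open>The mean height: it is the expectation of the barycentric coordinate of \<open>v\<close>,
    because this coordinate of \<open>pt \<tau> y\<close> is \<open>\<tau>\<close>.\<close>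
  have mean: "(\<integral>\<tau>. \<tau> \<partial>\<rho>) = 1 / m"
  proof -
    obtain M c where M: "linear M" "\<And>w. w \<in> W \<Longrightarrow> c + M w = (if w = v then 1 else 0 :: real)"
      using affine_independent_extend[OF W, of "\<lambda>w. if w = v then 1 else 0 :: real"] by blast
    have Mm[measurable]: "(\<lambda>x. c + M x) \<in> borel_measurable borel"
      by (rule borel_measurable_continuous_onI[OF continuous_on_affine_map[OF M(1)]])
    have M0: "c + M y = 0" if "y \<in> affine hull F" for y
    proof -
      have "c + M y = 0 + (0::real)"
        using that unfolding aF
        by (rule affine_maps_eq_on_affine_hull[OF M(1) linear_zero, rotated]) (simp add: M(2) W'_def)
      then show ?thesis by simp
    qed
    have inner: "(\<integral>y. c + M (pt \<tau> y) \<partial>U) = \<tau>" for \<tau>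
    proof -
      have "AE y in U. c + M (pt \<tau> y) = \<tau>"
        using AE_uniform_on[OF F] unfolding U_def
      proof eventually_elim
        case (elim y)
        have "M (pt \<tau> y) = \<tau> * M v + (1 - \<tau>) * M y"
          using M(1) by (simp add: pt_def linear_add linear_scale)
        then have "c + M (pt \<tau> y) = \<tau> * (c + M v) + (1 - \<tau>) * (c + M y)"
          by (simp add: algebra_simps)
        then show ?case using M(2)[OF v] M0[of y] elim by (simp add: hull_inc)
      qed
      then have "(\<integral>y. c + M (pt \<tau> y) \<partial>U) = (\<integral>y. \<tau> \<partial>U)"
        by (intro integral_cong_AE) auto
      then show ?thesis by (simp add: U.prob_space)
    qed
    have "1 / m = (\<integral>x. c + M x \<partial>uniform_on S)"
      unfolding S_def m_def using M by (intro expectation_barycentric_coordinate[OF W v, symmetric]) (auto simp: v)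
    also have "\<dots> = (\<integral>p. c + M (case p of (\<tau>, y) \<Rightarrow> pt \<tau> y) \<partial>(\<rho> \<Otimes>\<^sub>M U))"
      unfolding \<rho>(4) U_def[symmetric] by (rule integral_distr) measurable
    also have "\<dots> = (\<integral>\<tau>. \<integral>y. c + M (pt \<tau> y) \<partial>U \<partial>\<rho>)"
    proof -
      have "integrable (uniform_on S) (\<lambda>x. c + M x)"
        by (rule integrable_uniform_on_continuous[OF S continuous_on_affine_map[OF M(1)]])
      then have "integrable (\<rho> \<Otimes>\<^sub>M U) (\<lambda>p. c + M (case p of (\<tau>, y) \<Rightarrow> pt \<tau> y))"
        unfolding \<rho>(4) U_def[symmetric] by (subst (asm) integrable_distr_eq) auto
      from P.integral_fst'[OF this] show ?thesis by simp
    qed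
    finally show ?thesis by (simp add: inner)
  qed
  have "G (1 / m) \<le> (\<integral>\<tau>. G \<tau> \<partial>\<rho>)"
    using R.jensens_inequality[OF idint, of "{0<..<1}" 0 1 G] \<rho>(3) Gint Gconv
    by (simp add: mean)
  moreover have "G (1 / m) = average_on (convex hull (\<phi> ` W')) f"
  proof -
    have 01: "0 < 1 / m" "1 / m < 1" using m by (simp_all add: field_simps)
    have \<phi>: "\<phi> y = (1 / m) *\<^sub>R v + (1 - 1 / m) *\<^sub>R y" for y by (simp add: \<phi>_def m_def)
    have lin: "linear (\<lambda>y::'a. (1 - 1 / m) *\<^sub>R y)" by (rule linear_scaleR)
    have inj: "inj \<phi>" using 01 by (auto simp: inj_def \<phi>)
    have ph: "\<phi> = pt (1 / m)" by (simp add: fun_eq_iff \<phi> pt_def)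
    define T where "T = convex hull (\<phi> ` W')"
    have T: "T = \<phi> ` F" unfolding T_def F_def by (rule convex_hull_affine_image[OF lin \<phi>])
    have UT: "uniform_on T = distr U borel \<phi>"
      unfolding T U_def by (rule uniform_on_affine_image[OF F lin \<phi>]) (use inj in \<open>auto intro: inj_on_subset\<close>)
    have TS: "T \<subseteq> S"
      unfolding T_def S_def
    proof (rule hull_minimal)
      show "\<phi> ` W' \<subseteq> convex hull W"
      proof clarify
        fix w assume "w \<in> W'"
        then have "w \<in> convex hull W" "v \<in> convex hull W" using v by (auto simp: W'_def hull_inc)
        then show "\<phi> w \<in> convex hull W" unfolding \<phi> using 01 by (intro convexD) auto
      qed
    qed simp
    have fT: "convex_on T f" using TS by (intro convex_on_subset[OF f]) (simp_all add: S_def T_def)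
    have Tri: "AE x in uniform_on T. x \<in> rel_interior T"
      unfolding T_def using W' by (intro AE_uniform_on_rel_interior affine_independent_affine_image[OF _ lin \<phi> inj]) auto
    have Sri: "AE x in uniform_on T. x \<in> rel_interior S"
      unfolding UT using ri rel_interior_borel[of S]
      by (subst AE_distr_iff) (auto simp: ph intro: ptri[OF 01] elim: eventually_mono)
    have sT: "sets (uniform_on T) = sets borel" by (simp add: UT)
    have "average_on T f = (\<integral>x. g x \<partial>uniform_on T)"
      unfolding average_on_def
    proof (rule integral_cong_AE)
      show "(\<lambda>x. indicator (rel_interior T) x * f x) \<in> borel_measurable (uniform_on T)"
        using convex_on_rel_interior_borel_measurable[OF fT] measurable_cong_sets[OF sT refl] by blast
      show "g \<in> borel_measurable (uniform_on T)" using gm measurable_cong_sets[OF sT refl] by blast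
      show "AE x in uniform_on T. indicator (rel_interior T) x * f x = g x"
        using Tri Sri by eventually_elim (simp add: gf)
    qed
    also have "\<dots> = G (1 / m)" unfolding UT G_def ph by (rule integral_distr) measurable
    finally show ?thesis by (simp add: T_def)
  qed
  ultimately show ?thesis using avg by (simp add: S_def W'_def)
qed

section \<open>The chain of sub-simplices\<close>

text \<open>
  With \<open>m\<close> the number of vertices of the sub-simplex of \<open>K\<close>, this exhibits the sub-simplex of \<open>L = insert p K\<close> as
  the section of the former at height \<open>1 / m\<close>, counted from the facet opposite to the vertex with
  index \<open>p\<close>.
\<close>

lemma sub_vertex_insert:
  fixes x :: "nat \<Rightarrow> 'a::euclidean_space"
  assumes K: "K \<subseteq> {0..n}" and p: "p \<in> {0..n} - K"
  shows "sub_vertex n x (insert p K) j =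
    (1 / (real n + 1 - card K)) *\<^sub>R sub_vertex n x K p + (1 - 1 / (real n + 1 - card K)) *\<^sub>R sub_vertex n x K j"
proof -
  have fin: "finite K" using K finite_subset by blast
  have "card K < card {0..n}" using K p by (intro psubset_card_mono) auto
  define m where "m = real n + 1 - real (card K)"
  have m: "m > 0" using \<open>card K < card {0..n}\<close> by (simp add: m_def)
  have m': "real n + 1 - real (card (insert p K)) = m - 1" using fin p by (simp add: m_def)
  define s where "s = (\<Sum>i\<in>K. x i)"
  have "1 - 1 / m = (m - 1) / m" using m by (simp add: diff_divide_distrib)
  then have c: "(1 / m) * (m / (real n + 1)) = 1 / (real n + 1)"
    "(1 - 1 / m) * (m / (real n + 1)) = (m - 1) / (real n + 1)"
    using m by simp_all
  have vec: "a *\<^sub>R (b *\<^sub>R t + d *\<^sub>R y) + (1 - a) *\<^sub>R (b *\<^sub>R t + d *\<^sub>R z)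
    = b *\<^sub>R t + (a * d) *\<^sub>R y + ((1 - a) * d) *\<^sub>R z" for a b d :: real and t y z :: 'a
    by (simp add: algebra_simps)
  have "(1 / m) *\<^sub>R ((1 / (real n + 1)) *\<^sub>R s + (m / (real n + 1)) *\<^sub>R x p)
      + (1 - 1 / m) *\<^sub>R ((1 / (real n + 1)) *\<^sub>R s + (m / (real n + 1)) *\<^sub>R x j)
    = (1 / (real n + 1)) *\<^sub>R s + (1 / (real n + 1)) *\<^sub>R x p + ((m - 1) / (real n + 1)) *\<^sub>R x j"
    unfolding vec c ..
  also have "\<dots> = (1 / (real n + 1)) *\<^sub>R (x p + s) + ((m - 1) / (real n + 1)) *\<^sub>R x j"
    by (simp add: scaleR_add_right add_ac)
  finally show ?thesis
    using fin p unfolding sub_vertex_def m' m_def[symmetric] s_def[symmetric] by (simp add: s_def)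
qed

lemma sub_vertex_in_simplex:
  assumes K: "K \<subseteq> {0..n}" and j: "j \<in> {0..n} - K"
  shows "sub_vertex n x K j \<in> convex hull (x ` {0..n})"
proof -
  have fin: "finite K" using K finite_subset by blast
  have "card K \<le> card {0..n}" using K by (intro card_mono) auto
  then have k: "real (card K) \<le> real n + 1" by simp
  define u where "u i = (if i = j then (real n + 1 - card K) / (real n + 1) else 1 / (real n + 1))" for i
  have "(\<Sum>i\<in>insert j K. u i *\<^sub>R x i) \<in> convex hull (x ` {0..n})"
  proof (rule convex_sum)
    have "sum u (insert j K) = u j + (\<Sum>i\<in>K. 1 / (real n + 1))"
    proof -
      have "sum u K = (\<Sum>i\<in>K. 1 / (real n + 1))"
        using j by (intro sum.cong) (auto simp: u_def)
      then show ?thesis using fin j by simp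
    qed
    also have "\<dots> = (real n + 1) / (real n + 1)"
      by (simp add: u_def flip: add_divide_distrib)
    also have "\<dots> = 1" by (rule divide_self) linarith
    finally show "sum u (insert j K) = 1" .
    show "0 \<le> u i" for i using k by (simp add: u_def)
    show "x i \<in> convex hull x ` {0..n}" if "i \<in> insert j K" for i
      using that K j by (intro hull_inc) auto
  qed (use fin in auto)
  also have "(\<Sum>i\<in>insert j K. u i *\<^sub>R x i) = u j *\<^sub>R x j + (\<Sum>i\<in>K. (1 / (real n + 1)) *\<^sub>R x i)"
  proof -
    have "(\<Sum>i\<in>K. u i *\<^sub>R x i) = (\<Sum>i\<in>K. (1 / (real n + 1)) *\<^sub>R x i)"
      using j by (intro sum.cong) (auto simp: u_def)
    then show ?thesis using fin j by simp
  qed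
  also have "\<dots> = sub_vertex n x K j"
    by (simp add: sub_vertex_def u_def scaleR_sum_right add.commute)
  finally show ?thesis .
qed

lemma
  fixes x :: "nat \<Rightarrow> 'a::euclidean_space"
  assumes aff: "\<not> affine_dependent (x ` {0..n})" and inj: "inj_on x {0..n}" and K: "K \<subset> {0..n}"
  shows sub_vertex_affine_independent: "\<not> affine_dependent (sub_vertex n x K ` ({0..n} - K))"
    and sub_vertex_inj_on: "inj_on (sub_vertex n x K) ({0..n} - K)"
proof -
  define \<psi> where "\<psi> z = (1 / (real n + 1)) *\<^sub>R (\<Sum>i\<in>K. x i) + ((real n + 1 - real (card K)) / (real n + 1)) *\<^sub>R z" for z
  have "card K < card {0..n}" using K by (intro psubset_card_mono) auto
  then have "real (card K) < real n + 1" by simp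
  then have inj\<psi>: "inj \<psi>" by (auto simp: inj_def \<psi>_def)
  have s: "sub_vertex n x K = (\<lambda>j. \<psi> (x j))" by (simp add: fun_eq_iff \<psi>_def sub_vertex_def)
  have "\<not> affine_dependent (x ` ({0..n} - K))"
    using aff by (rule affine_independent_subset) auto
  then have "\<not> affine_dependent (\<psi> ` x ` ({0..n} - K))"
    by (rule affine_independent_affine_image[OF _ linear_scaleR \<psi>_def inj\<psi>])
  then show "\<not> affine_dependent (sub_vertex n x K ` ({0..n} - K))" by (simp add: s image_image)
  show "inj_on (sub_vertex n x K) ({0..n} - K)"
  proof (rule inj_onI)
    fix i j assume "i \<in> {0..n} - K" "j \<in> {0..n} - K" "sub_vertex n x K i = sub_vertex n x K j"
    then show "i = j" using inj_onD[OF inj] injD[OF inj\<psi>] by (simp add: s)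
  qed
qed

lemma average_on_sub_simplex_insert_le:
  fixes x :: "nat \<Rightarrow> 'a::euclidean_space"
  assumes aff: "\<not> affine_dependent (x ` {0..n})" and inj: "inj_on x {0..n}"
    and f: "convex_on (convex hull (x ` {0..n})) f"
    and p: "p \<notin> K" and L: "insert p K \<subset> {0..n}"
  shows "average_on (sub_simplex n x (insert p K)) f \<le> average_on (sub_simplex n x K) f"
proof -
  have K: "K \<subset> {0..n}" using L by auto
  have pN: "p \<in> {0..n} - K" using p L by auto
  define W where "W = sub_vertex n x K ` ({0..n} - K)"
  define v where "v = sub_vertex n x K p"
  have W: "\<not> affine_dependent W" unfolding W_def by (rule sub_vertex_affine_independent[OF aff inj K])
  have injK: "inj_on (sub_vertex n x K) ({0..n} - K)" by (rule sub_vertex_inj_on[OF aff inj K])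
  have v: "v \<in> W" using pN by (simp add: v_def W_def)
  have W': "W - {v} = sub_vertex n x K ` ({0..n} - insert p K)"
  proof -
    have "W - {v} = sub_vertex n x K ` (({0..n} - K) - {p})"
      unfolding W_def v_def using inj_on_image_set_diff[OF injK, of "{0..n} - K" "{p}"] pN by simp
    also have "({0..n} - K) - {p} = {0..n} - insert p K" by auto
    finally show ?thesis .
  qed
  have "{0..n} - insert p K \<noteq> {}" using L by blast
  then have "W - {v} \<noteq> {}" unfolding W' by simp
  then have ne: "W \<noteq> {v}" by blast
  have "card W = card ({0..n} - K)" unfolding W_def by (rule card_image[OF injK])
  also have "\<dots> = card {0..n} - card K" using K by (intro card_Diff_subset) (auto intro: finite_subset)
  finally have m: "real (card W) = real n + 1 - real (card K)"
    using card_mono[of "{0..n}" K] K by (simp add: of_nat_diff psubset_imp_subset)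
  have fW: "convex_on (convex hull W) f"
  proof (rule convex_on_subset[OF f])
    show "convex hull W \<subseteq> convex hull (x ` {0..n})"
      unfolding W_def
      by (intro hull_minimal image_subsetI sub_vertex_in_simplex psubset_imp_subset[OF K] convex_convex_hull)
  qed simp
  have step: "sub_vertex n x (insert p K) j
      = (1 / card W) *\<^sub>R v + (1 - 1 / card W) *\<^sub>R sub_vertex n x K j" for j
    unfolding m v_def by (rule sub_vertex_insert[OF psubset_imp_subset[OF K] pN])
  have "sub_vertex n x (insert p K) ` ({0..n} - insert p K)
      = (\<lambda>y. (1 / card W) *\<^sub>R v + (1 - 1 / card W) *\<^sub>R y) ` (W - {v})"
    unfolding W' image_image step ..
  then show ?thesis
    using average_on_section_le[OF W v ne fW] unfolding sub_simplex_def W_def[symmetric] by simp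
qed

lemma average_on_sub_simplex_antimono:
  fixes x :: "nat \<Rightarrow> 'a::euclidean_space"
  assumes aff: "\<not> affine_dependent (x ` {0..n})" and inj: "inj_on x {0..n}"
    and f: "convex_on (convex hull (x ` {0..n})) f"
    and KL: "K \<subseteq> L" and L: "L \<subset> {0..n}"
  shows "average_on (sub_simplex n x L) f \<le> average_on (sub_simplex n x K) f"
proof -
  have "average_on (sub_simplex n x (K \<union> D)) f \<le> average_on (sub_simplex n x K) f"
    if "finite D" "D \<inter> K = {}" "K \<union> D \<subset> {0..n}" for D
    using that
  proof (induction D rule: finite_induct)
    case (insert p D)
    have "average_on (sub_simplex n x (insert p (K \<union> D))) f \<le> average_on (sub_simplex n x (K \<union> D)) f"
      using insert by (intro average_on_sub_simplex_insert_le[OF aff inj f]) auto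
    also have "\<dots> \<le> average_on (sub_simplex n x K) f" using insert by auto
    finally show ?case by simp
  qed simp
  moreover have "finite (L - K)" using L by (metis finite_Diff finite_atLeastAtMost finite_subset psubset_imp_subset)
  moreover have "K \<union> (L - K) = L" using KL by blast
  ultimately show ?thesis using L by (metis Diff_disjoint inf_commute)
qed

theorem theorem2p1:
  fixes n :: nat
    and x :: "nat \<Rightarrow> real ^ 'n"
    and f :: "real ^ 'n \<Rightarrow> real"
    and K L :: "nat set"
  assumes "n = CARD('n)"
    and "inj_on (\<lambda>i. x i - x 0) {1..n}"
    and "independent ((\<lambda>i. x i - x 0) ` {1..n})"
    and "convex_on (convex hull (x ` {0..n})) f"
    and "K \<subseteq> L" and "L \<subset> {0..n}"
  shows "1 / rel_volume (sub_simplex n x L) * rel_integral (sub_simplex n x L) f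
       \<le> 1 / rel_volume (sub_simplex n x K) * rel_integral (sub_simplex n x K) f"
proof -
  have ne0: "x i \<noteq> x 0" if "i \<in> {1..n}" for i
  proof
    assume "x i = x 0"
    then have "0 = x i - x 0" by simp
    then have "0 \<in> (\<lambda>i. x i - x 0) ` {1..n}" using that by (rule image_eqI)
    then show False using assms(3) dependent_zero[of "(\<lambda>i. x i - x 0) ` {1..n}"] by simp
  qed
  have N: "{0..n} = insert 0 {1..n}" by auto
  have x0: "x 0 \<notin> x ` {1..n}"
  proof
    assume "x 0 \<in> x ` {1..n}"
    then obtain i where "i \<in> {1..n}" "x 0 = x i" by (elim imageE)
    then show False using ne0[of i] by simp
  qed
  have inj: "inj_on x {0..n}"
    unfolding N inj_on_insert
  proof
    show "inj_on x {1..n}"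
    proof (rule inj_onI)
      fix i j assume "i \<in> {1..n}" "j \<in> {1..n}" "x i = x j"
      then show "i = j" using inj_onD[OF assms(2), of i j] by simp
    qed
    show "x 0 \<notin> x ` ({1..n} - {0})" using x0 by simp
  qed
  have "x ` {0..n} - {x 0} = x ` {1..n}" unfolding N using x0 by simp
  then have shift: "(\<lambda>z. - x 0 + z) ` (x ` {0..n} - {x 0}) = (\<lambda>i. x i - x 0) ` {1..n}"
    by (simp add: image_image)
  have "x 0 \<in> x ` {0..n}" by (rule imageI) simp
  then have aff: "\<not> affine_dependent (x ` {0..n})"
    unfolding affine_dependent_iff_dependent2[OF \<open>x 0 \<in> x ` {0..n}\<close>] shift using assms(3) by blast
  have avg: "1 / rel_volume (sub_simplex n x J) * rel_integral (sub_simplex n x J) f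
      = average_on (sub_simplex n x J) f" if J: "J \<subset> {0..n}" for J
    unfolding sub_simplex_def
  proof (rule rel_integral_div_rel_volume)
    show "\<not> affine_dependent (sub_vertex n x J ` ({0..n} - J))"
      by (rule sub_vertex_affine_independent[OF aff inj J])
    show "sub_vertex n x J ` ({0..n} - J) \<noteq> {}" using J by blast
    show "convex_on (convex hull sub_vertex n x J ` ({0..n} - J)) f"
    proof (rule convex_on_subset[OF assms(4)])
      show "convex hull sub_vertex n x J ` ({0..n} - J) \<subseteq> convex hull x ` {0..n}"
        by (intro hull_minimal image_subsetI sub_vertex_in_simplex psubset_imp_subset[OF J] convex_convex_hull)
    qed simp
  qed
  have "K \<subset> {0..n}" using assms(5,6) by (rule subset_psubset_trans)
  then show ?thesis
    unfolding avg[OF \<open>K \<subset> {0..n}\<close>] avg[OF assms(6)]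
    by (intro average_on_sub_simplex_antimono[OF aff inj assms(4-6)])
qed

end
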